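(* Let $(\mathcal C,\mathcal D)$ be a regular inclusion, and let $F\subseteq\mathfrak S(\mathcal C,\mathcal D)$ be a closed $\mathcal N(\mathcal C,\mathcal D)$-invariant set such that the restriction map $f\mapsto f|_{\mathcal D}$ maps $F$ onto $\hat{\mathcal D}$. Then $\mathcal E^1_F(\mathcal C,\mathcal D)$ and $\mathfrak R_F(\mathcal C,\mathcal D)$ are locally compact Hausdorff topological groupoids and $\mathfrak R_F(\mathcal C,\mathcal D)$ is an étale groupoid. Their unit spaces are $\mathcal E^1_F(\mathcal C,\mathcal D)^{(\circ)}=\mathfrak R_F(\mathcal C,\mathcal D)^{(\circ)}=F$. Moreover, $\mathcal E^1_F(\mathcal C,\mathcal D)$ is a locally trivial topological twist over $\mathfrak R_F(\mathcal C,\mathcal D)$.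
   Context: All $C^*$-algebras are unital. An inclusion is a pair $(\mathcal C,\mathcal D)$ where $\mathcal C$ is a unital $C^*$-algebra and $\mathcal D\subseteq\mathcal C$ is an abelian $C^*$-subalgebra containing the unit of $\mathcal C$. Its normalizers are $\mathcal N(\mathcal C,\mathcal D)=\{v\in\mathcal C: v^*\mathcal Dv\cup v\mathcal Dv^*\subseteq\mathcal D\}$. The inclusion is regular if $\operatorname{span}\mathcal N(\mathcal C,\mathcal D)$ is norm dense in $\mathcal C$. $\hat{\mathcal D}$ is the space of characters of $\mathcal D$. $\mathfrak S(\mathcal C,\mathcal D)$ is the set of states $\rho$ on $\mathcal C$ with $|\rho(v)|^2\in\{0,\rho(v^*v)\}$ for all $v\in\mathcal N(\mathcal C,\mathcal D)$, with the relative weak-$*$ topology; such states restrict to characters of $\mathcal D$. $F$ is $\mathcal N(\mathcal C,\mathcal D)$-invariant if for all $f\in F$ and $v\in\mathcal N(\mathcal C,\mathcal D)$ with $f(v^*v)\ne0$, the state $x\mapsto f(v^*xv)/f(v^*v)$ belongs to $F$. For $v\in\mathcal N(\mathcal C,\mathcal D)$ and $f\in\mathfrak S(\mathcal C,\mathcal D)$ with $f(v^*v)\neq0$, let $[v,f]$ be the norm-one functional on $\mathcal C$ given by $[v,f](x)=f(v^*x)/f(v^*v)^{1/2}$. Let $\mathcal E^1_F(\mathcal C,\mathcal D)=\{[v,f]: v\in\mathcal N(\mathcal C,\mathcal D),\ f\in F,\ f(v^*v)\neq0\}$ with the relative weak-$*$ topology. For $\phi\in\mathcal E^1_F(\mathcal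 C,\mathcal D)$ there are unique $\mathfrak s(\phi),\mathfrak r(\phi)\in F$ (source and range) such that $\phi(vx)=\phi(v)\,\mathfrak s(\phi)(x)$ and $\phi(xv)=\mathfrak r(\phi)(x)\,\phi(v)$ for all $x\in\mathcal C$ and all $v\in\mathcal N(\mathcal C,\mathcal D)$ with $\phi(v)\ne0$; if $\phi(v)>0$ then $\phi=[v,\mathfrak s(\phi)]$. The inverse is $\phi^{-1}(x)=\overline{\phi(x^* )}$; $(\phi_1,\phi_2)$ is composable if $\mathfrak s(\phi_1)=\mathfrak r(\phi_2)$, and then $\phi_1\phi_2=[v_1v_2,\mathfrak s(\phi_2)]$ where $v_i\in\mathcal N(\mathcal C,\mathcal D)$ satisfy $\phi_i(v_i)>0$ (this is well defined). $\mathbb T$ acts by $(z\phi)(x)=\phi(zx)$. Let $\mathfrak R_F(\mathcal C,\mathcal D)=\{|\phi|:\phi\in\mathcal E^1_F(\mathcal C,\mathcal D)\}$, where $|\phi|$ is the function $x\mapsto|\phi(x)|$ on $\mathcal C$, with the topology of pointwise convergence on $\mathcal C$ and the operations $\mathfrak s(|\phi|)=\mathfrak s(\phi)$, $\mathfrak r(|\phi|)=\mathfrak r(\phi)$, $|\phi|^{-1}=|\phi^{-1}|$, $|\phi||\psi|=|\phi\psi|$ for composable $\phi,\psi$. A state $f\in F$ is identified with $|f|$. A pair $(\Sigma,G)$ is a twist ($\Sigma$ is a twist over $G$) if $\Sigma$ and $G$ are Hausdorff locally compact topological groupoids, $G$ is étale, and: (1) there is a free action of $\mathbb T$ by homeomorphisms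 of $\Sigma$ such that if $(\sigma_1,\sigma_2)$ is composable and $z_1,z_2\in\mathbb T$, then $(z_1\sigma_1,z_2\sigma_2)$ is composable and $(z_1\sigma_1)(z_2\sigma_2)=(z_1z_2)(\sigma_1\sigma_2)$; (2) there is a continuous surjective groupoid homomorphism $\gamma:\Sigma\to G$ with $\gamma^{-1}(\gamma(\sigma))=\{z\sigma:z\in\mathbb T\}$ for every $\sigma$; (3) the bundle $(\Sigma,G,\gamma)$ is locally trivial. Here the $\mathbb T$-action is the one above and $\gamma(\phi)=|\phi|$. *)

theory Defs
  imports "HOL-Analysis.Analysis"
begin

text \<open>
  The distribution has no complex vector spaces, so complex scalars are added to a real Banach
  algebra and tied to the real ones by \<open>scaleR_scaleC\<close>.  The zero algebra is not excluded;
  this is why the class does not extend \<open>real_normed_algebra_1\<close>.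
\<close>

class unital_cstar_algebra = real_normed_algebra + banach + monoid_mult +
  fixes scaleC :: "complex \<Rightarrow> 'a \<Rightarrow> 'a" (infixr "*\<^sub>C" 75)
    and star :: "'a \<Rightarrow> 'a"
  assumes scaleC_add_right: "a *\<^sub>C (x + y) = a *\<^sub>C x + a *\<^sub>C y"
    and scaleC_add_left: "(a + b) *\<^sub>C x = a *\<^sub>C x + b *\<^sub>C x"
    and scaleC_scaleC: "a *\<^sub>C (b *\<^sub>C x) = (a * b) *\<^sub>C x"
    and scaleR_scaleC: "scaleR r x = complex_of_real r *\<^sub>C x"
    and scaleC_mult_left: "(a *\<^sub>C x) * y = a *\<^sub>C (x * y)"
    and scaleC_mult_right: "x * (a *\<^sub>C y) = a *\<^sub>C (x * y)"
    and norm_scaleC: "norm (a *\<^sub>C x) = cmod a * norm x"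
    and star_add: "star (x + y) = star x + star y"
    and star_scaleC: "star (a *\<^sub>C x) = cnj a *\<^sub>C star x"
    and star_mult: "star (x * y) = star y * star x"
    and star_star: "star (star x) = x"
    and cstar_identity: "norm (star x * x) = (norm x)\<^sup>2"

text \<open>
  The large algebra \<open>\<C>\<close> of an inclusion is the whole type \<open>'a\<close>; the small one is a set \<open>D\<close>.
\<close>

definition inclusion :: "'a::unital_cstar_algebra set \<Rightarrow> bool" where
  "inclusion D \<longleftrightarrow>
     1 \<in> D \<and> closed D \<and>
     (\<forall>x\<in>D. \<forall>y\<in>D. x + y \<in> D \<and> x * y \<in> D \<and> x * y = y * x) \<and>
     (\<forall>x\<in>D. star x \<in> D \<and> (\<forall>a. a *\<^sub>C x \<in> D))"

definition normalizers :: "'a::unital_cstar_algebra set \<Rightarrow> 'a set" where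
  "normalizers D = {v. \<forall>d\<in>D. star v * d * v \<in> D \<and> v * d * star v \<in> D}"

definition regular_inclusion :: "'a::unital_cstar_algebra set \<Rightarrow> bool" where
  "regular_inclusion D \<longleftrightarrow>
     inclusion D \<and> closure (module.span scaleC (normalizers D)) = UNIV"

text \<open>
  Functionals on \<open>\<C>\<close> are elements of \<open>'a \<Rightarrow> complex\<close>.  The topology of this function type in
  HOL-Analysis is that of pointwise convergence, hence its subspace topologies on sets of
  bounded functionals are the relative weak-* topologies.
\<close>

definition state :: "('a::unital_cstar_algebra \<Rightarrow> complex) \<Rightarrow> bool" where
  "state f \<longleftrightarrow>
     bounded_linear f \<and> (\<forall>a x. f (a *\<^sub>C x) = a * f x) \<and>
     (\<forall>x. f (star x * x) \<in> \<real>\<^sub>\<ge>\<^sub>0) \<and> f 1 = 1"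

text \<open>Characters of \<open>D\<close> are functions on \<open>D\<close> only, i.e. they are extensional outside \<open>D\<close>.\<close>

definition characters :: "'a::unital_cstar_algebra set \<Rightarrow> ('a \<Rightarrow> complex) set" where
  "characters D = {k \<in> extensional D.
     (\<forall>x\<in>D. \<forall>y\<in>D. k (x + y) = k x + k y \<and> k (x * y) = k x * k y) \<and>
     (\<forall>x\<in>D. \<forall>a. k (a *\<^sub>C x) = a * k x) \<and>
     (\<exists>x\<in>D. k x \<noteq> 0)}"

definition compatible_states :: "'a::unital_cstar_algebra set \<Rightarrow> ('a \<Rightarrow> complex) set" where
  "compatible_states D = {\<rho>. state \<rho> \<and>
     (\<forall>v\<in>normalizers D. complex_of_real ((cmod (\<rho> v))\<^sup>2) \<in> {0, \<rho> (star v * v)})}"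

definition normalizer_invariant ::
  "'a::unital_cstar_algebra set \<Rightarrow> ('a \<Rightarrow> complex) set \<Rightarrow> bool" where
  "normalizer_invariant D F \<longleftrightarrow>
     (\<forall>f\<in>F. \<forall>v\<in>normalizers D. f (star v * v) \<noteq> 0 \<longrightarrow>
        (\<lambda>x. f (star v * x * v) / f (star v * v)) \<in> F)"

text \<open>
  The arrows are the points of the topology \<open>gtop\<close>; units are identified with their identity
  arrows, so source and range map arrows to arrows.
\<close>

record 'g groupoid_data =
  gtop :: "'g topology"
  gsrc :: "'g \<Rightarrow> 'g"
  grng :: "'g \<Rightarrow> 'g"
  gmult :: "'g \<Rightarrow> 'g \<Rightarrow> 'g"
  ginv :: "'g \<Rightarrow> 'g"

definition arrows :: "'g groupoid_data \<Rightarrow> 'g set" where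
  "arrows G = topspace (gtop G)"

definition unit_space :: "'g groupoid_data \<Rightarrow> 'g set" where
  "unit_space G = gsrc G ` arrows G"

definition composable :: "'g groupoid_data \<Rightarrow> ('g \<times> 'g) set" where
  "composable G = {(g, h). g \<in> arrows G \<and> h \<in> arrows G \<and> gsrc G g = grng G h}"

locale groupoid =
  fixes G :: "'g groupoid_data"
  assumes src_closed: "g \<in> arrows G \<Longrightarrow> gsrc G g \<in> arrows G"
    and rng_closed: "g \<in> arrows G \<Longrightarrow> grng G g \<in> arrows G"
    and src_src: "g \<in> arrows G \<Longrightarrow> gsrc G (gsrc G g) = gsrc G g"
    and rng_src: "g \<in> arrows G \<Longrightarrow> grng G (gsrc G g) = gsrc G g"
    and src_rng: "g \<in> arrows G \<Longrightarrow> gsrc G (grng G g) = grng G g"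
    and rng_rng: "g \<in> arrows G \<Longrightarrow> grng G (grng G g) = grng G g"
    and mult_closed: "(g, h) \<in> composable G \<Longrightarrow> gmult G g h \<in> arrows G"
    and src_mult: "(g, h) \<in> composable G \<Longrightarrow> gsrc G (gmult G g h) = gsrc G h"
    and rng_mult: "(g, h) \<in> composable G \<Longrightarrow> grng G (gmult G g h) = grng G g"
    and mult_assoc: "\<lbrakk>(g, h) \<in> composable G; (h, k) \<in> composable G\<rbrakk>
          \<Longrightarrow> gmult G (gmult G g h) k = gmult G g (gmult G h k)"
    and mult_src: "g \<in> arrows G \<Longrightarrow> gmult G g (gsrc G g) = g"
    and rng_mult_left: "g \<in> arrows G \<Longrightarrow> gmult G (grng G g) g = g"
    and inv_closed: "g \<in> arrows G \<Longrightarrow> ginv G g \<in> arrows G"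
    and src_inv: "g \<in> arrows G \<Longrightarrow> gsrc G (ginv G g) = grng G g"
    and rng_inv: "g \<in> arrows G \<Longrightarrow> grng G (ginv G g) = gsrc G g"
    and inv_mult: "g \<in> arrows G \<Longrightarrow> gmult G (ginv G g) g = gsrc G g"
    and mult_inv: "g \<in> arrows G \<Longrightarrow> gmult G g (ginv G g) = grng G g"

locale topological_groupoid = groupoid +
  assumes continuous_mult:
      "continuous_map (subtopology (prod_topology (gtop G) (gtop G)) (composable G)) (gtop G)
         (\<lambda>(g, h). gmult G g h)"
    and continuous_inv: "continuous_map (gtop G) (gtop G) (ginv G)"

locale lch_groupoid = topological_groupoid +
  assumes Hausdorff: "Hausdorff_space (gtop G)"
    and locally_compact: "locally_compact_space (gtop G)"

definition local_homeomorphism_map ::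
  "'a topology \<Rightarrow> 'b topology \<Rightarrow> ('a \<Rightarrow> 'b) \<Rightarrow> bool" where
  "local_homeomorphism_map X Y f \<longleftrightarrow>
     (\<forall>x \<in> topspace X. \<exists>U. openin X U \<and> x \<in> U \<and> openin Y (f ` U) \<and>
        homeomorphic_map (subtopology X U) (subtopology Y (f ` U)) f)"

locale etale_groupoid = topological_groupoid +
  assumes local_homeo_src:
      "local_homeomorphism_map (gtop G) (subtopology (gtop G) (unit_space G)) (gsrc G)"
    and local_homeo_rng:
      "local_homeomorphism_map (gtop G) (subtopology (gtop G) (unit_space G)) (grng G)"

abbreviation circle :: "complex set" where
  "circle \<equiv> sphere 0 1"

text \<open>
  Local triviality is that of a bundle with fibre the circle group: the trivialisations
  intertwine the action with multiplication in the second factor.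
\<close>

locale twist = S: lch_groupoid S + G: lch_groupoid G + G: etale_groupoid G
  for S :: "'s groupoid_data" and G :: "'g groupoid_data"
    and act :: "complex \<Rightarrow> 's \<Rightarrow> 's" and \<gamma> :: "'s \<Rightarrow> 'g" +
  assumes act_one: "s \<in> arrows S \<Longrightarrow> act 1 s = s"
    and act_act: "\<lbrakk>z \<in> circle; w \<in> circle; s \<in> arrows S\<rbrakk> \<Longrightarrow> act z (act w s) = act (z * w) s"
    and act_homeo: "z \<in> circle \<Longrightarrow> homeomorphic_map (gtop S) (gtop S) (act z)"
    and act_free: "\<lbrakk>z \<in> circle; s \<in> arrows S; act z s = s\<rbrakk> \<Longrightarrow> z = 1"
    and act_composable: "\<lbrakk>z \<in> circle; w \<in> circle; (s, t) \<in> composable S\<rbrakk>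
          \<Longrightarrow> (act z s, act w t) \<in> composable S"
    and act_mult: "\<lbrakk>z \<in> circle; w \<in> circle; (s, t) \<in> composable S\<rbrakk>
          \<Longrightarrow> gmult S (act z s) (act w t) = act (z * w) (gmult S s t)"
    and proj_continuous: "continuous_map (gtop S) (gtop G) \<gamma>"
    and proj_surj: "\<gamma> ` arrows S = arrows G"
    and proj_composable: "(s, t) \<in> composable S \<Longrightarrow> (\<gamma> s, \<gamma> t) \<in> composable G"
    and proj_mult: "(s, t) \<in> composable S \<Longrightarrow> \<gamma> (gmult S s t) = gmult G (\<gamma> s) (\<gamma> t)"
    and proj_fibre: "s \<in> arrows S \<Longrightarrow> {t \<in> arrows S. \<gamma> t = \<gamma> s} = (\<lambda>z. act z s) ` circle"
    and locally_trivial: "g \<in> arrows G \<Longrightarrow> \<exists>U h. openin (gtop G) U \<and> g \<in> U \<and>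
          homeomorphic_map (prod_topology (subtopology (gtop G) U) (top_of_set circle))
            (subtopology (gtop S) {s \<in> arrows S. \<gamma> s \<in> U}) h \<and>
          (\<forall>u\<in>U. \<forall>z\<in>circle. \<gamma> (h (u, z)) = u \<and>
             (\<forall>w\<in>circle. h (u, w * z) = act w (h (u, z))))"

text \<open>
  For a state \<open>f\<close> the number \<open>f (star v * v)\<close> is real and nonnegative, so \<open>csqrt\<close> is its
  nonnegative square root.
\<close>

definition bracket ::
  "'a::unital_cstar_algebra \<Rightarrow> ('a \<Rightarrow> complex) \<Rightarrow> 'a \<Rightarrow> complex" where
  "bracket v f = (\<lambda>x. f (star v * x) / csqrt (f (star v * v)))"

definition E1 ::
  "'a::unital_cstar_algebra set \<Rightarrow> ('a \<Rightarrow> complex) set \<Rightarrow> ('a \<Rightarrow> complex) set" where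
  "E1 D F = {bracket v f | v f. v \<in> normalizers D \<and> f \<in> F \<and> f (star v * v) \<noteq> 0}"

definition E1_src ::
  "'a::unital_cstar_algebra set \<Rightarrow> ('a \<Rightarrow> complex) set \<Rightarrow> ('a \<Rightarrow> complex) \<Rightarrow> 'a \<Rightarrow> complex" where
  "E1_src D F \<phi> = (THE f. f \<in> F \<and>
     (\<forall>v\<in>normalizers D. \<phi> v \<noteq> 0 \<longrightarrow> (\<forall>x. \<phi> (v * x) = \<phi> v * f x)))"

definition E1_rng ::
  "'a::unital_cstar_algebra set \<Rightarrow> ('a \<Rightarrow> complex) set \<Rightarrow> ('a \<Rightarrow> complex) \<Rightarrow> 'a \<Rightarrow> complex" where
  "E1_rng D F \<phi> = (THE f. f \<in> F \<and>
     (\<forall>v\<in>normalizers D. \<phi> v \<noteq> 0 \<longrightarrow> (\<forall>x. \<phi> (x * v) = f x * \<phi> v)))"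

definition E1_inv ::
  "('a::unital_cstar_algebra \<Rightarrow> complex) \<Rightarrow> 'a \<Rightarrow> complex" where
  "E1_inv \<phi> = (\<lambda>x. cnj (\<phi> (star x)))"

definition E1_mult ::
  "'a::unital_cstar_algebra set \<Rightarrow> ('a \<Rightarrow> complex) set \<Rightarrow>
     ('a \<Rightarrow> complex) \<Rightarrow> ('a \<Rightarrow> complex) \<Rightarrow> 'a \<Rightarrow> complex" where
  "E1_mult D F \<phi>1 \<phi>2 = (THE \<psi>. \<exists>v1\<in>normalizers D. \<exists>v2\<in>normalizers D.
     \<phi>1 v1 \<in> \<real> \<and> 0 < Re (\<phi>1 v1) \<and> \<phi>2 v2 \<in> \<real> \<and> 0 < Re (\<phi>2 v2) \<and>
     \<psi> = bracket (v1 * v2) (E1_src D F \<phi>2))"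

definition E1_act ::
  "complex \<Rightarrow> ('a::unital_cstar_algebra \<Rightarrow> complex) \<Rightarrow> 'a \<Rightarrow> complex" where
  "E1_act z \<phi> = (\<lambda>x. \<phi> (z *\<^sub>C x))"

definition E1_groupoid ::
  "'a::unital_cstar_algebra set \<Rightarrow> ('a \<Rightarrow> complex) set \<Rightarrow> ('a \<Rightarrow> complex) groupoid_data" where
  "E1_groupoid D F =
     \<lparr>gtop = top_of_set (E1 D F), gsrc = E1_src D F, grng = E1_rng D F,
      gmult = E1_mult D F, ginv = E1_inv\<rparr>"

definition modulus ::
  "('a::unital_cstar_algebra \<Rightarrow> complex) \<Rightarrow> 'a \<Rightarrow> real" where
  "modulus \<phi> = (\<lambda>x. cmod (\<phi> x))"

text \<open>
  The operations on absolute values are prescribed on representatives in \<open>E1 D F\<close>.  The topology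
  is again that of the function type.  Units are the absolute values of the states in \<open>F\<close>.
\<close>

definition R_groupoid ::
  "'a::unital_cstar_algebra set \<Rightarrow> ('a \<Rightarrow> complex) set \<Rightarrow> ('a \<Rightarrow> real) groupoid_data" where
  "R_groupoid D F =
     \<lparr>gtop = top_of_set (modulus ` E1 D F),
      gsrc = (\<lambda>\<rho>. THE \<tau>. \<exists>\<phi>\<in>E1 D F. \<rho> = modulus \<phi> \<and> \<tau> = modulus (E1_src D F \<phi>)),
      grng = (\<lambda>\<rho>. THE \<tau>. \<exists>\<phi>\<in>E1 D F. \<rho> = modulus \<phi> \<and> \<tau> = modulus (E1_rng D F \<phi>)),
      gmult = (\<lambda>\<rho> \<sigma>. THE \<tau>. \<exists>\<phi>\<in>E1 D F. \<exists>\<psi>\<in>E1 D F. \<rho> = modulus \<phi> \<and> \<sigma> = modulus \<psi> \<and>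
                 E1_src D F \<phi> = E1_rng D F \<psi> \<and> \<tau> = modulus (E1_mult D F \<phi> \<psi>)),
      ginv = (\<lambda>\<rho>. THE \<tau>. \<exists>\<phi>\<in>E1 D F. \<rho> = modulus \<phi> \<and> \<tau> = modulus (E1_inv \<phi>))\<rparr>"

end

theory Submission
  imports Defs
begin

text \<open>
  A state in \<open>F\<close> is multiplicative on \<open>D\<close>, so \<open>D\<close> lies in its multiplicative domain.  If
  \<open>[v, f](w) \<noteq> 0\<close> for normalizers \<open>v\<close> and \<open>w\<close>, then the Cauchy--Schwarz inequality for
  \<open>v\<close> and \<open>w\<close> is an equality, and \<open>[v, f]\<close> is a unimodular multiple of \<open>[w, f]\<close>.  Hence on
  the open set \<open>{\<phi>. \<phi> v \<noteq> 0}\<close> a functional \<open>\<phi>\<close> is determined by its source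
  \<open>x \<mapsto> \<phi> (v * x) / \<phi> v\<close> and the phase of \<open>\<phi> v\<close>, and this chart is a local
  trivialization.  The product is \<open>(\<phi>\<psi>)(x) = \<phi> (x * star w) / cnj (\<psi> w)\<close> for every
  normalizer \<open>w\<close> with \<open>\<psi> w \<noteq> 0\<close>, from which its continuity can be read off.  Local
  compactness comes from the compactness of \<open>F\<close>.  By polarization a state is determined by its
  absolute value, continuously, so the same charts describe the quotient by the circle.
\<close>

section \<open>States\<close>

text \<open>Every multiplicativity used below at normalizers has one source. If \<open>f\<close> is
  compatible and \<open>f v \<noteq> 0\<close> for a normalizer \<open>v\<close>, then equality
  holds in |f(v)|^2 \<le> f (star v * v), and Cauchy-Schwarz lets \<open>f v\<close> be pulled out
  of products. Normalizers are closed under products and adjoints, so this applies to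
  \<open>star v * w\<close>, hence to the values of \<open>[v, f]\<close> at normalizers. The
  obstacle is choice: a functional has many representatives \<open>[v, f]\<close>, and source, range
  and product are given by descriptions. Each operation is therefore computed on representatives and
  then rewritten with a test normalizer at which the functional is merely nonzero. Positivity at the
  test normalizer would not be an open condition; nonvanishing is, so one formula serves a whole
  neighbourhood. Absolute values of these formulas give the operations on \<open>R_groupoid\<close>,
  whose topology is pointwise convergence and not a quotient topology by definition.\<close>

lemma scaleC_one [simp]: "1 *\<^sub>C x = (x::'a::unital_cstar_algebra)"
  using scaleR_scaleC[of 1 x] by simp

lemma scaleC_minus_one: "(- 1) *\<^sub>C x = - (x::'a::unital_cstar_algebra)"
  using scaleR_scaleC[of "-1" x] by simp

lemma star_one [simp]: "star 1 = (1::'a::unital_cstar_algebra)"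
  by (metis mult_1_left mult_1_right star_mult star_star)

declare star_star [simp]

lemma star_diff: "star (x - y) = star x - star (y::'a::unital_cstar_algebra)"
  using star_add[of x "- y"] star_scaleC[of "-1" y] by (simp add: scaleC_minus_one)

lemma scaleC_diff_right: "a *\<^sub>C (x - y) = a *\<^sub>C x - a *\<^sub>C (y::'a::unital_cstar_algebra)"
  by (metis add_diff_cancel_right' diff_add_cancel scaleC_add_right)

context
  fixes f :: "'a::unital_cstar_algebra \<Rightarrow> complex"
  assumes f: "state f"
begin

lemma state_add: "f (x + y) = f x + f y"
  using f by (simp add: state_def bounded_linear.linear linear_add)

lemma state_diff: "f (x - y) = f x - f y"
  using f by (simp add: state_def bounded_linear.linear linear_diff)

lemma state_scaleC: "f (a *\<^sub>C x) = a * f x"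
  using f by (simp add: state_def)

lemma state_one: "f 1 = 1"
  using f by (simp add: state_def)

lemma state_nonneg: "f (star x * x) \<in> \<real>\<^sub>\<ge>\<^sub>0"
  using f by (simp add: state_def)

lemma state_star_mult_self:
  "f (star x * x) = complex_of_real (Re (f (star x * x)))" "0 \<le> Re (f (star x * x))"
  using state_nonneg[of x] by (auto simp: complex_nonneg_Reals_iff complex_eq_iff)

lemma state_star: "f (star x) = cnj (f x)"
proof -
  have real: "Im (f (star y) + f y) = 0" for y
  proof -
    have "star (1 + y) * (1 + y) = 1 + y + star y + star y * y"
      by (simp add: star_add algebra_simps)
    then have "f (star (1 + y) * (1 + y)) = 1 + f y + f (star y) + f (star y * y)"
      by (simp add: state_add state_one)
    with state_nonneg[of "1 + y"] state_nonneg[of y] show ?thesis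
      by (simp add: complex_nonneg_Reals_iff)
  qed
  \<comment> \<open>The instance at \<open>x\<close> makes the imaginary parts of
    \<open>f (star x)\<close> and \<open>f x\<close> opposite; the instance at
    \<open>\<i> *\<^sub>C x\<close> makes their real parts equal.\<close>
  from real[of x] real[of "\<i> *\<^sub>C x"] show ?thesis
    by (simp add: star_scaleC state_scaleC complex_eq_iff)
qed

lemma state_Cauchy_Schwarz:
  "(cmod (f (star y * x)))\<^sup>2 \<le> Re (f (star y * y)) * Re (f (star x * x))"
proof -
  define A where "A = Re (f (star x * x))"
  define B where "B = Re (f (star y * y))"
  define C where "C = f (star y * x)"
  have A: "f (star x * x) = of_real A" "0 \<le> A" and B: "f (star y * y) = of_real B" "0 \<le> B"
    using state_star_mult_self by (simp_all add: A_def B_def)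
  have C': "f (star x * y) = cnj C"
    using state_star[of "star y * x"] by (simp add: star_mult C_def)
  have pos: "0 \<le> A - 2 * t * (cmod C)\<^sup>2 + t\<^sup>2 * (cmod C)\<^sup>2 * B" for t :: real
  proof -
    \<comment> \<open>With \<open>a\<close> a real multiple of \<open>C\<close> both cross terms
      become t |C|^2, so positivity yields a real quadratic in \<open>t\<close>.\<close>
    define a where "a = of_real t * C"
    have "star (x - a *\<^sub>C y) * (x - a *\<^sub>C y)
       = star x * x - a *\<^sub>C (star x * y) - cnj a *\<^sub>C (star y * x) + (a * cnj a) *\<^sub>C (star y * y)"
      by (simp add: star_diff star_scaleC algebra_simps scaleC_mult_left scaleC_mult_right
          scaleC_scaleC scaleC_diff_right)
    then have "f (star (x - a *\<^sub>C y) * (x - a *\<^sub>C y)) = of_real A - a * cnj C - cnj a * C + (a * cnj a) * of_real B"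
      by (simp add: state_add state_diff state_scaleC A(1) B(1) C' flip: C_def)
    also have "\<dots> = of_real A - 2 * t * (C * cnj C) + t\<^sup>2 * (C * cnj C) * B"
      by (simp add: a_def algebra_simps power2_eq_square)
    also have "\<dots> = of_real (A - 2 * t * (cmod C)\<^sup>2 + t\<^sup>2 * (cmod C)\<^sup>2 * B)"
      by (simp add: complex_norm_square[symmetric])
    finally show ?thesis
      using state_star_mult_self(2)[of "x - a *\<^sub>C y"] by (simp only: Re_complex_of_real)
  qed
  have "(cmod C)\<^sup>2 \<le> B * A"
  proof (cases "B = 0")
    case True
    have "(cmod C)\<^sup>2 = 0"
    proof (rule ccontr)
      assume "(cmod C)\<^sup>2 \<noteq> 0"
      \<comment> \<open>For B = 0 the quadratic is affine in \<open>t\<close>, and this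
        \<open>t\<close> gives it the value -1.\<close>
      then show False using pos[of "(A + 1) / (2 * (cmod C)\<^sup>2)"] A(2) True by simp
    qed
    then show ?thesis using A B by simp
  next
    case False
    \<comment> \<open>The quadratic attains its minimum at t = 1 / B.\<close>
    then show ?thesis using pos[of "1 / B"] B(2)
      by (simp add: field_simps power2_eq_square)
  qed
  then show ?thesis by (simp add: A_def B_def C_def)
qed

lemma state_square_le: "(cmod (f x))\<^sup>2 \<le> Re (f (star x * x))"
  using state_Cauchy_Schwarz[of 1 x] by (simp add: state_one)

text \<open>The bound \<open>\<bar>f x\<bar>\<^sup>2 \<le> f (star x * x)\<close> improves any norm bound \<open>K\<close> of \<open>f\<close> to \<open>sqrt K\<close>.\<close>

lemma state_norm_le: "cmod (f x) \<le> norm x"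
proof -
  have bl: "bounded_linear f" using f by (simp add: state_def)
  define K where "K = onorm f"
  have K: "0 \<le> K" unfolding K_def using bl by (rule onorm_pos_le)
  have *: "cmod (f y) \<le> K * norm y" for y unfolding K_def using onorm[OF bl] .
  have "cmod (f y) \<le> sqrt K * norm y" for y
  proof -
    have "(cmod (f y))\<^sup>2 \<le> cmod (f (star y * y))"
      using state_square_le[of y] complex_Re_le_cmod order_trans by blast
    also have "\<dots> \<le> K * (norm y)\<^sup>2" using *[of "star y * y"] by (simp add: cstar_identity)
    finally have "sqrt ((cmod (f y))\<^sup>2) \<le> sqrt (K * (norm y)\<^sup>2)" by (rule real_sqrt_le_mono)
    then show ?thesis by (simp add: real_sqrt_mult)
  qed
  then have "K \<le> sqrt K" unfolding K_def[symmetric] using K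
    by (metis K_def onorm_bound real_sqrt_ge_zero)
  then have "K\<^sup>2 \<le> K" using K
    by (metis power_mono real_sqrt_pow2)
  then have "K \<le> 1" using K by (cases "K = 0") (auto simp: power2_eq_square)
  then show ?thesis using *[of x] mult_right_mono[of K 1 "norm x"] by simp
qed

text \<open>The one-sided multiplicative domain. The hypothesis says exactly that
  \<open>star u - cnj (f u) *\<^sub>C 1\<close> is null for \<open>f\<close>, and Cauchy-Schwarz
  then annihilates its products with every \<open>x\<close>.\<close>

lemma state_mult_left:
  assumes "f (u * star u) = f u * cnj (f u)"
  shows "f (u * x) = f u * f x"
proof -
  define y where "y = star u - cnj (f u) *\<^sub>C 1"
  have y: "star y = u - f u *\<^sub>C 1" by (simp add: y_def star_diff star_scaleC)
  have "star y * y = u * star u - f u *\<^sub>C star u - cnj (f u) *\<^sub>C u + (f u * cnj (f u)) *\<^sub>C 1"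
    unfolding y by (simp add: y_def algebra_simps scaleC_mult_left scaleC_mult_right
        scaleC_scaleC scaleC_diff_right)
  then have "f (star y * y) = 0"
    by (simp add: state_add state_diff state_scaleC state_one assms state_star)
  then have "f (star y * x) = 0"
    using state_Cauchy_Schwarz[of y x] by simp
  moreover have "star y * x = u * x - f u *\<^sub>C x"
    unfolding y by (simp add: algebra_simps scaleC_mult_left)
  ultimately show ?thesis by (simp add: state_diff state_scaleC)
qed

lemma state_mult_right:
  assumes "f (star u * u) = f u * cnj (f u)"
  shows "f (x * u) = f x * f u"
proof -
  have "f (star u * star x) = f (star u) * f (star x)"
    by (rule state_mult_left) (simp add: assms state_star)
  then have "cnj (f (x * u)) = cnj (f x * f u)"
    by (simp add: star_mult flip: state_star)
  then show ?thesis by (simp only: complex_cnj_cancel_iff)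
qed

end

text \<open>Inverts \<open>modulus\<close> on states via \<open>2 Re z = \<bar>1 + z\<bar>\<^sup>2 - 1 - \<bar>z\<bar>\<^sup>2\<close>.\<close>

definition unmodulus :: "('a::unital_cstar_algebra \<Rightarrow> real) \<Rightarrow> 'a \<Rightarrow> complex" where
  "unmodulus k = (\<lambda>x. Complex (((k (1 + x))\<^sup>2 - 1 - (k x)\<^sup>2) / 2)
     (((k (1 + (- \<i>) *\<^sub>C x))\<^sup>2 - 1 - (k x)\<^sup>2) / 2))"

lemma unmodulus_modulus:
  assumes "state f" shows "unmodulus (modulus f) = f"
proof
  fix x
  have *: "((cmod (1 + z))\<^sup>2 - 1 - (cmod z)\<^sup>2) / 2 = Re z" for z
    unfolding cmod_power2 by (simp add: power2_eq_square algebra_simps)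
  \<comment> \<open>The imaginary part of \<open>z\<close> is the real part of
    \<open>- \<i> * z\<close>, so the same polarization applies.\<close>
  have "((cmod (1 - \<i> * z))\<^sup>2 - 1 - (cmod z)\<^sup>2) / 2 = Im z" for z
    unfolding cmod_power2 by (simp add: power2_eq_square algebra_simps)
  then show "unmodulus (modulus f) x = f x"
    using * by (simp add: unmodulus_def modulus_def state_add[OF assms] state_scaleC[OF assms]
      state_one[OF assms] complex_eq_iff)
qed

lemma modulus_state_inject: "\<lbrakk>state f; state g; modulus f = modulus g\<rbrakk> \<Longrightarrow> f = g"
  by (metis unmodulus_modulus)

text \<open>Banach-Alaoglu for states: the uniform bound by the norm places them in a product of
  discs, which is compact by Tychonoff, and closedness is meant in the pointwise topology.\<close>

lemma compact_states:
  fixes S :: "('a::unital_cstar_algebra \<Rightarrow> complex) set"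
  assumes "closed S" "\<And>f. f \<in> S \<Longrightarrow> state f"
  shows "compact S"
proof -
  have "compactin (product_topology (\<lambda>i. euclidean) UNIV) (PiE UNIV (\<lambda>x::'a. cball (0::complex) (norm x)))"
    by (simp add: compactin_PiE)
  then have "compact (PiE UNIV (\<lambda>x::'a. cball (0::complex) (norm x)))"
    by (simp add: euclidean_product_topology)
  moreover have "S \<subseteq> PiE UNIV (\<lambda>x::'a. cball (0::complex) (norm x))"
    using assms(2) by (auto simp: state_norm_le)
  ultimately show ?thesis
    using assms(1) by (metis compact_Int_closed inf.absorb_iff2)
qed

text \<open>Boundedness with an unspecified constant is not visibly a closed condition. Replacing it
  by the bound with constant 1 turns each clause into one that survives pointwise limits.\<close>

lemma state_iff:
  "state f \<longleftrightarrow> (\<forall>x y. f (x + y) = f x + f y) \<and> (\<forall>a x. f (a *\<^sub>C x) = a * f x) \<and>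
     (\<forall>x. cmod (f x) \<le> norm x) \<and> (\<forall>x. f (star x * x) \<in> \<real>\<^sub>\<ge>\<^sub>0) \<and> f 1 = 1" (is "_ \<longleftrightarrow> ?rhs")
proof
  assume "state f" then show ?rhs
    by (simp add: state_add state_scaleC state_norm_le state_nonneg state_one)
next
  assume r: ?rhs
  have "bounded_linear f"
    by (rule bounded_linear_intro[where K=1])
      (use r in \<open>auto simp: scaleR_scaleC scaleR_conv_of_real\<close>)
  then show "state f" using r by (simp add: state_def)
qed

lemma closed_compatible_states: "closed (compatible_states D)"
proof -
  have ev: "continuous_on UNIV (\<lambda>f::'a \<Rightarrow> complex. f x)" for x
    by (simp add: continuous_on_product_coordinates)
  \<comment> \<open>The alternative in the definition of compatibility becomes the vanishing of a
    product, which is a closed equation in \<open>f\<close>.\<close>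
  have eq: "compatible_states D =
     (\<Inter>x y. {f. f (x + y) = f x + f y}) \<inter> (\<Inter>a x. {f. f (a *\<^sub>C x) = a * f x}) \<inter>
     (\<Inter>x. {f. cmod (f x) \<le> norm x}) \<inter> (\<Inter>x. {f. f (star x * x) \<in> \<real>\<^sub>\<ge>\<^sub>0}) \<inter> {f. f 1 = 1} \<inter>
     (\<Inter>v\<in>normalizers D. {f. of_real ((cmod (f v))\<^sup>2) * (of_real ((cmod (f v))\<^sup>2) - f (star v * v)) = 0})"
    by (auto simp: compatible_states_def state_iff)
  have nn: "closed {f::'a \<Rightarrow> complex. f (star x * x) \<in> \<real>\<^sub>\<ge>\<^sub>0}" for x
  proof -
    have "{f::'a \<Rightarrow> complex. f (star x * x) \<in> \<real>\<^sub>\<ge>\<^sub>0} =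
       {f. 0 \<le> Re (f (star x * x))} \<inter> {f. Im (f (star x * x)) = 0}"
      by (auto simp: complex_nonneg_Reals_iff)
    then show ?thesis
      by (auto intro!: closed_Int closed_Collect_eq closed_Collect_le continuous_intros ev)
  qed
  show ?thesis unfolding eq
    by (intro closed_Int closed_INT ballI closed_Collect_eq closed_Collect_le nn
        continuous_intros ev)
qed

section \<open>Normalizers and compatible states\<close>

abbreviation weight :: "('a::unital_cstar_algebra \<Rightarrow> complex) \<Rightarrow> 'a \<Rightarrow> real" where
  "weight f v \<equiv> Re (f (star v * v))"

text \<open>The state that normalizer invariance puts into \<open>F\<close>. It turns out to be the
  range of \<open>[v, f]\<close>.\<close>

definition translate ::
  "'a::unital_cstar_algebra \<Rightarrow> ('a \<Rightarrow> complex) \<Rightarrow> 'a \<Rightarrow> complex" where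
  "translate v f = (\<lambda>x. f (star v * x * v) / f (star v * v))"

locale invariant_state_set =
  fixes D :: "'a::unital_cstar_algebra set" and F :: "('a \<Rightarrow> complex) set"
  assumes incl: "inclusion D"
    and F_compatible: "F \<subseteq> compatible_states D"
    and F_closed: "closedin (top_of_set (compatible_states D)) F"
    and F_invariant: "normalizer_invariant D F"
    and F_characters: "(\<lambda>f. restrict f D) ` F \<subseteq> characters D"
begin

abbreviation N :: "'a set" where "N \<equiv> normalizers D"

lemma D_one: "1 \<in> D" and D_mult: "\<lbrakk>x \<in> D; y \<in> D\<rbrakk> \<Longrightarrow> x * y \<in> D"
  and D_commute: "\<lbrakk>x \<in> D; y \<in> D\<rbrakk> \<Longrightarrow> x * y = y * x"
  and D_star: "x \<in> D \<Longrightarrow> star x \<in> D" and D_scaleC: "x \<in> D \<Longrightarrow> a *\<^sub>C x \<in> D"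
  using incl by (auto simp: inclusion_def)

lemma N_conj: "\<lbrakk>v \<in> N; d \<in> D\<rbrakk> \<Longrightarrow> star v * d * v \<in> D"
  and N_conj': "\<lbrakk>v \<in> N; d \<in> D\<rbrakk> \<Longrightarrow> v * d * star v \<in> D"
  by (auto simp: normalizers_def)

lemma N_star_mult: "v \<in> N \<Longrightarrow> star v * v \<in> D"
  and N_mult_star: "v \<in> N \<Longrightarrow> v * star v \<in> D"
  using N_conj[OF _ D_one] N_conj'[OF _ D_one] by auto

lemma N_star: "v \<in> N \<Longrightarrow> star v \<in> N"
  by (simp add: normalizers_def)

lemma D_subset_N: "d \<in> D \<Longrightarrow> d \<in> N"
  by (simp add: normalizers_def D_mult D_star)

lemma N_one: "1 \<in> N"
  by (simp add: D_subset_N D_one)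

lemma N_mult:
  assumes "u \<in> N" "v \<in> N" shows "u * v \<in> N"
proof -
  have "star (u * v) * d * (u * v) \<in> D \<and> (u * v) * d * star (u * v) \<in> D" if "d \<in> D" for d
  proof -
    have "star (u * v) * d * (u * v) = star v * (star u * d * u) * v"
      "(u * v) * d * star (u * v) = u * (v * d * star v) * star u"
      by (simp_all add: star_mult mult.assoc)
    with that assms show ?thesis by (simp add: N_conj N_conj')
  qed
  then show ?thesis by (simp add: normalizers_def)
qed

lemma N_scaleC: "v \<in> N \<Longrightarrow> a *\<^sub>C v \<in> N"
  by (simp add: normalizers_def star_scaleC scaleC_mult_left scaleC_mult_right scaleC_scaleC D_scaleC)

lemma F_state: "f \<in> F \<Longrightarrow> state f"
  using F_compatible by (auto simp: compatible_states_def)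

lemma F_compact: "compact F"
proof -
  have "closed F"
    using F_closed closed_compatible_states closedin_closed_trans by blast
  then show ?thesis using F_state compact_states by blast
qed

lemma translate_in_F: "\<lbrakk>f \<in> F; v \<in> N; f (star v * v) \<noteq> 0\<rbrakk> \<Longrightarrow> translate v f \<in> F"
  using F_invariant by (simp add: normalizer_invariant_def translate_def)

context
  fixes f assumes f: "f \<in> F"
begin

lemmas f_state = F_state[OF f]

lemma F_D_left: "d \<in> D \<Longrightarrow> f (d * x) = f d * f x"
  and F_D_right: "d \<in> D \<Longrightarrow> f (x * d) = f x * f d"
proof -
  have m: "f (d * e) = f d * f e" if "d \<in> D" "e \<in> D" for d e
  proof -
    have "restrict f D \<in> characters D" using F_characters f by auto
    then have "restrict f D (d * e) = restrict f D d * restrict f D e"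
      using that by (simp add: characters_def)
    with that D_mult[OF that] show ?thesis by simp
  qed
  show "d \<in> D \<Longrightarrow> f (d * x) = f d * f x" "d \<in> D \<Longrightarrow> f (x * d) = f x * f d"
    by (rule state_mult_left[OF f_state] state_mult_right[OF f_state],
        simp add: m D_star state_star[OF f_state])+
qed

lemma F_N_norm:
  assumes "v \<in> N" "f v \<noteq> 0" shows "f (star v * v) = f v * cnj (f v)"
proof -
  have "complex_of_real ((cmod (f v))\<^sup>2) \<in> {0, f (star v * v)}"
    using F_compatible f assms(1) unfolding compatible_states_def by blast
  with assms(2) have "f (star v * v) = complex_of_real ((cmod (f v))\<^sup>2)" by auto
  then show ?thesis by (simp only: complex_norm_square)
qed

text \<open>Multiplicativity from the left needs the equality for \<open>v * star v\<close>, hence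
  compatibility is applied to \<open>star v\<close>.\<close>

lemma F_N_left: "\<lbrakk>v \<in> N; f v \<noteq> 0\<rbrakk> \<Longrightarrow> f (v * x) = f v * f x"
  using F_N_norm[of "star v"]
  by (intro state_mult_left[OF f_state]) (simp add: N_star state_star[OF f_state])

lemma F_N_right: "\<lbrakk>v \<in> N; f v \<noteq> 0\<rbrakk> \<Longrightarrow> f (x * v) = f x * f v"
  by (intro state_mult_right[OF f_state] F_N_norm)

lemma F_weight: "f (star v * v) = of_real (weight f v)" and F_weight_nonneg: "0 \<le> weight f v"
  using state_star_mult_self[OF f_state] by blast+

lemma F_star_swap: "f (star w * v) = cnj (f (star v * w))"
  using state_star[OF f_state, of "star v * w"] by (simp add: star_mult)

lemma weight_one: "weight f 1 = 1"
  by (simp add: state_one[OF f_state])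

lemma bracket_eq: "bracket v f x = f (star v * x) / of_real (sqrt (weight f v))"
  using F_weight[of v] F_weight_nonneg[of v] unfolding bracket_def
  by (metis Im_complex_of_real Re_complex_of_real csqrt_of_real_nonneg)

lemma bracket_self: "bracket v f v = of_real (sqrt (weight f v))"
proof -
  have "bracket v f v = of_real (weight f v / sqrt (weight f v))"
    using F_weight[of v] by (simp add: bracket_eq)
  also have "weight f v / sqrt (weight f v) = sqrt (weight f v)"
    using F_weight_nonneg by (rule real_div_sqrt)
  finally show ?thesis .
qed

lemma bracket_one: "bracket 1 f = f"
  by (rule ext) (simp add: bracket_eq weight_one state_one[OF f_state])

lemma bracket_scaleC: "bracket v f (a *\<^sub>C x) = a * bracket v f x"
  by (simp add: bracket_eq scaleC_mult_right state_scaleC[OF f_state])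

text \<open>The weight of \<open>star v\<close> at the range state equals the weight of
  \<open>v\<close> at the source state, so inversion keeps the normalizing factor of a
  bracket.\<close>

lemma translate_self_weight:
  assumes "v \<in> N" "weight f v \<noteq> 0"
  shows "translate v f (v * star v) = of_real (weight f v)"
proof -
  have "f (star v * (v * star v) * v) = f (star v * v * (star v * v))" by (simp add: mult.assoc)
  then show ?thesis using assms F_weight[of v]
    by (simp add: translate_def F_D_left N_star_mult)
qed

text \<open>For \<open>f (star v * w) \<noteq> 0\<close> the Cauchy--Schwarz inequality for \<open>v\<close> and \<open>w\<close> is an equality,
  because \<open>v * star v\<close> and \<open>w * star w\<close> commute.\<close>

lemma F_parallel:
  assumes v: "v \<in> N" and w: "w \<in> N" and vw: "f (star v * w) \<noteq> 0"
  shows "f (star v * v) * f (star w * w) = f (star v * w) * f (star w * v)"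
    and "f (star v * w) * f (star w * x) = f (star w * w) * f (star v * x)"
proof -
  have vwN: "star v * w \<in> N" using v w by (simp add: N_mult N_star)
  have wv: "f (star w * v) = cnj (f (star v * w))" by (rule F_star_swap)
  have vv: "f (star v * v) \<noteq> 0"
    using vw state_Cauchy_Schwarz[OF f_state, of v w] by auto
  \<comment> \<open>Both sides evaluate \<open>f\<close> at the product of
    \<open>star v * v\<close>, \<open>star v * w\<close> and \<open>star w * y\<close>. Factoring
    directly gives the left side; commuting \<open>v * star v\<close> with \<open>w * star w\<close>
    first gives the right side.\<close>
  have A: "f (star v * v) * (f (star v * w) * f (star w * y))
      = f (star v * w) * f (star w * v) * f (star v * y)" for y
  proof -
    have "f (star v * v) * (f (star v * w) * f (star w * y))
        = f (star v * v) * f (star v * w * (star w * y))"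
      by (simp add: F_N_left vwN vw)
    also have "\<dots> = f (star v * v * (star v * w * (star w * y)))"
      by (simp add: F_D_left N_star_mult v)
    also have "star v * v * (star v * w * (star w * y)) = star v * ((v * star v) * (w * star w)) * y"
      by (simp add: mult.assoc)
    also have "\<dots> = star v * ((w * star w) * (v * star v)) * y"
      by (simp only: D_commute[OF N_mult_star[OF v] N_mult_star[OF w]])
    also have "\<dots> = (star v * (w * star w) * v) * (star v * y)"
      by (simp add: mult.assoc)
    also have "f \<dots> = f (star v * (w * star w) * v) * f (star v * y)"
      by (rule F_D_left) (simp add: N_conj N_mult_star v w)
    also have "star v * (w * star w) * v = star v * w * (star w * v)"
      by (simp add: mult.assoc)
    also have "f \<dots> = f (star v * w) * f (star w * v)"
      by (simp add: F_N_left vwN vw)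
    finally show ?thesis .
  qed
  from A[of w] vw show B: "f (star v * v) * f (star w * w) = f (star v * w) * f (star w * v)"
    by simp
  from A[of x] have "f (star v * v) * (f (star v * w) * f (star w * x))
      = f (star v * v) * (f (star w * w) * f (star v * x))"
    by (simp flip: B)
  with vv show "f (star v * w) * f (star w * x) = f (star w * w) * f (star v * x)"
    by simp
qed

end

text \<open>Up to the normalizing factor the value at \<open>w\<close> is
  \<open>f (star v * w)\<close>, so its nonvanishing makes \<open>f\<close> multiplicative at the
  normalizer \<open>star v * w\<close>.\<close>

lemma bracket_mult_right:
  assumes f: "f \<in> F" and v: "v \<in> N" and w: "w \<in> N" and vw: "bracket v f w \<noteq> 0"
  shows "bracket v f (w * x) = bracket v f w * f x"
  using F_N_left[OF f, of "star v * w" x] vw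
  by (auto simp: bracket_eq[OF f] N_mult N_star v w simp flip: mult.assoc)

text \<open>Equality in Cauchy-Schwarz makes \<open>\<bar>[v, f](w)\<bar>\<close> independent of
  \<open>v\<close>: its square is the weight of \<open>w\<close>. Because brackets are normalized by
  the square root of the weight, the factor relating two of them is a pure phase.\<close>

lemma bracket_weight:
  assumes f: "f \<in> F" and v: "v \<in> N" and w: "w \<in> N" and vw: "bracket v f w \<noteq> 0"
  shows "weight f w = (cmod (bracket v f w))\<^sup>2" "weight f w \<noteq> 0" "weight f v \<noteq> 0"
    and "bracket v f x = sgn (bracket v f w) * bracket w f x"
proof -
  have nz: "f (star v * w) \<noteq> 0" "weight f v \<noteq> 0"
    using vw by (auto simp: bracket_eq[OF f])
  then show "weight f v \<noteq> 0" by simp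
  then have pos: "0 < weight f v" using F_weight_nonneg[OF f, of v] by simp
  have "complex_of_real (weight f v * weight f w) = of_real ((cmod (f (star v * w)))\<^sup>2)"
    unfolding of_real_mult F_weight[OF f, symmetric] complex_norm_square
      F_star_swap[OF f, of w v, symmetric]
    by (rule F_parallel(1)[OF f v w nz(1)])
  then have e: "weight f v * weight f w = (cmod (f (star v * w)))\<^sup>2"
    by (simp only: of_real_eq_iff)
  have e2: "(cmod (bracket v f w))\<^sup>2 = (cmod (f (star v * w)))\<^sup>2 / weight f v"
    using pos by (simp add: bracket_eq[OF f] norm_divide power_divide)
  show w1: "weight f w = (cmod (bracket v f w))\<^sup>2"
    unfolding e2 using e pos by (simp add: field_simps)
  then show w2: "weight f w \<noteq> 0" using vw by simp
  have sq: "sqrt (weight f w) = cmod (bracket v f w)" unfolding w1 by simp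
  have "bracket v f w * f (star w * x) = of_real (weight f w) * bracket v f x"
    using F_parallel(2)[OF f v w nz(1), of x] F_weight[OF f, of w] by (simp add: bracket_eq[OF f])
  then have "bracket v f x = bracket v f w * f (star w * x) / of_real (weight f w)"
    using w2 by simp
  also have "\<dots> = sgn (bracket v f w) * bracket w f x"
    unfolding bracket_eq[OF f, of w] sq w1 by (simp add: sgn_eq power2_eq_square)
  finally show "bracket v f x = sgn (bracket v f w) * bracket w f x" .
qed

text \<open>Multiplying by \<open>f (star w * v)\<close> moves \<open>star w * v\<close> inside
  \<open>f\<close>, where \<open>w * star w\<close> appears between \<open>star v\<close> and
  \<open>v\<close>. It lies in \<open>D\<close>, so it can be split off under the state
  \<open>translate v f\<close>. Reading the same manipulation backwards with \<open>x\<close>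
  removed allows the factor to be cancelled.\<close>

lemma bracket_mult_left:
  assumes f: "f \<in> F" and v: "v \<in> N" and w: "w \<in> N" and vw: "bracket v f w \<noteq> 0"
  shows "bracket v f (x * w) = translate v f x * bracket v f w"
proof -
  note g = translate_in_F[OF f v]
  have nz: "f (star v * w) \<noteq> 0" "weight f v \<noteq> 0"
    using vw by (auto simp: bracket_eq[OF f])
  then have vv: "f (star v * v) \<noteq> 0" by auto
  have wv: "f (star w * v) \<noteq> 0" using nz(1) F_star_swap[OF f, of w v] by simp
  have wvN: "star w * v \<in> N" using v w by (simp add: N_mult N_star)
  have t: "f (star v * y * v) = translate v f y * f (star v * v)" for y
    using vv by (simp add: translate_def)
  have "f (star v * (x * w)) * f (star w * v) = f (star v * (x * (w * star w)) * v)"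
    using F_N_right[OF f wvN wv, of "star v * (x * w)"] by (simp add: mult.assoc)
  also have "\<dots> = translate v f x * translate v f (w * star w) * f (star v * v)"
    by (simp only: t F_D_right[OF g[OF vv] N_mult_star[OF w]])
  also have "\<dots> = translate v f x * f (star v * (w * star w) * v)"
    unfolding t by (rule mult.assoc)
  also have "f (star v * (w * star w) * v) = f (star v * w) * f (star w * v)"
    using F_N_right[OF f wvN wv, of "star v * w"] by (simp add: mult.assoc)
  finally have "f (star v * (x * w)) = translate v f x * f (star v * w)"
    using wv by simp
  then show ?thesis by (simp add: bracket_eq[OF f])
qed

text \<open>Uniqueness comes from testing at \<open>v\<close> itself: the bracket does not vanish
  there, so the defining equation can be solved for the candidate state.\<close>

lemma E1_src_bracket:
  assumes f: "f \<in> F" and v: "v \<in> N" and vv: "weight f v \<noteq> 0"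
  shows "E1_src D F (bracket v f) = f"
proof -
  have nz: "bracket v f v \<noteq> 0" using vv by (simp add: bracket_self[OF f])
  show ?thesis unfolding E1_src_def
  proof (rule the_equality)
    show "f \<in> F \<and> (\<forall>w\<in>N. bracket v f w \<noteq> 0 \<longrightarrow> (\<forall>x. bracket v f (w * x) = bracket v f w * f x))"
      using f v bracket_mult_right by blast
  next
    fix g assume "g \<in> F \<and> (\<forall>w\<in>N. bracket v f w \<noteq> 0 \<longrightarrow> (\<forall>x. bracket v f (w * x) = bracket v f w * g x))"
    then show "g = f"
      using bracket_mult_right[OF f v v nz] nz v by (metis ext mult_left_cancel)
  qed
qed

lemma E1_rng_bracket:
  assumes f: "f \<in> F" and v: "v \<in> N" and vv: "weight f v \<noteq> 0"
  shows "E1_rng D F (bracket v f) = translate v f"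
proof -
  have nz: "bracket v f v \<noteq> 0" using vv by (simp add: bracket_self[OF f])
  have t: "translate v f \<in> F" using translate_in_F[OF f v] vv by fastforce
  show ?thesis unfolding E1_rng_def
  proof (rule the_equality)
    show "translate v f \<in> F \<and> (\<forall>w\<in>N. bracket v f w \<noteq> 0 \<longrightarrow>
        (\<forall>x. bracket v f (x * w) = translate v f x * bracket v f w))"
      using f v t bracket_mult_left by blast
  next
    fix g assume "g \<in> F \<and> (\<forall>w\<in>N. bracket v f w \<noteq> 0 \<longrightarrow> (\<forall>x. bracket v f (x * w) = g x * bracket v f w))"
    then show "g = translate v f"
      using bracket_mult_left[OF f v v nz] nz v by (metis ext mult_right_cancel)
  qed
qed

section \<open>The groupoid of normalized functionals\<close>

lemma weight_translate:
  "\<lbrakk>f \<in> F; v \<in> N\<rbrakk> \<Longrightarrow> weight (translate v f) u = weight f (u * v) / weight f v"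
  using F_weight[of f v] unfolding translate_def
  by (metis Re_divide_of_real mult.assoc star_mult)

lemma translate_translate:
  assumes "f \<in> F" "v \<in> N" "weight f v \<noteq> 0"
  shows "translate u (translate v f) = translate (u * v) f"
proof
  fix x
  have "f (star v * v) \<noteq> 0" using assms by auto
  then show "translate u (translate v f) x = translate (u * v) f x"
    by (simp add: translate_def star_mult mult.assoc)
qed

text \<open>Applied to \<open>star v * v\<close>, this makes translation by \<open>star v\<close>
  undo translation by \<open>v\<close>; applied to 1, it identifies the range of a unit.\<close>

lemma translate_D:
  assumes "f \<in> F" "d \<in> D" "f d \<noteq> 0"
  shows "translate d f = f"
proof
  fix x
  have "f (star d) \<noteq> 0" using assms by (simp add: state_star[OF F_state])
  with assms show "translate d f x = f x"
    by (simp add: translate_def F_D_left F_D_right D_star mult.assoc)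
qed

lemma bracket_in_E1: "\<lbrakk>f \<in> F; v \<in> N; weight f v \<noteq> 0\<rbrakk> \<Longrightarrow> bracket v f \<in> E1 D F"
  unfolding E1_def by fastforce

lemma E1_cases:
  assumes "\<phi> \<in> E1 D F"
  obtains v f where "v \<in> N" "f \<in> F" "weight f v \<noteq> 0" "\<phi> = bracket v f"
proof -
  obtain v f where *: "v \<in> N" "f \<in> F" "f (star v * v) \<noteq> 0" "\<phi> = bracket v f"
    using assms unfolding E1_def by blast
  then have "weight f v \<noteq> 0" using F_weight[of f v] by fastforce
  with * that show ?thesis by blast
qed

lemma translate_F: "\<lbrakk>f \<in> F; v \<in> N; weight f v \<noteq> 0\<rbrakk> \<Longrightarrow> translate v f \<in> F"
  using translate_in_F by fastforce

lemma src_in_F: "\<phi> \<in> E1 D F \<Longrightarrow> E1_src D F \<phi> \<in> F"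
  and rng_in_F: "\<phi> \<in> E1 D F \<Longrightarrow> E1_rng D F \<phi> \<in> F"
  by (auto elim!: E1_cases simp: E1_src_bracket E1_rng_bracket translate_F)

lemma E1_scaleC: "\<phi> \<in> E1 D F \<Longrightarrow> \<phi> (a *\<^sub>C x) = a * \<phi> x"
  by (auto elim!: E1_cases simp: bracket_scaleC)

lemma E1_act_eq: "\<phi> \<in> E1 D F \<Longrightarrow> E1_act z \<phi> = (\<lambda>x. z * \<phi> x)"
  by (simp add: E1_act_def E1_scaleC)

lemma F_subset_E1: "F \<subseteq> E1 D F"
  using bracket_in_E1[OF _ N_one] bracket_one weight_one by fastforce

lemma E1_src_F: "f \<in> F \<Longrightarrow> E1_src D F f = f" and E1_rng_F: "f \<in> F \<Longrightarrow> E1_rng D F f = f"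
proof -
  assume f: "f \<in> F"
  have "translate 1 f = f" using translate_D[OF f D_one] by (simp add: state_one[OF F_state[OF f]])
  then show "E1_src D F f = f" "E1_rng D F f = f"
    using E1_src_bracket[OF f N_one] E1_rng_bracket[OF f N_one] f
    by (simp_all add: bracket_one state_one[OF F_state])
qed

lemma E1_positive:
  assumes "\<phi> \<in> E1 D F"
  obtains v c where "v \<in> N" "\<phi> v = of_real c" "0 < c"
proof -
  obtain v f where v: "v \<in> N" "f \<in> F" "weight f v \<noteq> 0" "\<phi> = bracket v f"
    using E1_cases[OF assms] .
  moreover have "0 < sqrt (weight f v)" using v F_weight_nonneg[of f v] by simp
  ultimately show ?thesis using that bracket_self by blast
qed

lemma E1_nonzero:
  assumes "\<phi> \<in> E1 D F"
  obtains v where "v \<in> N" "\<phi> v \<noteq> 0"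
  using E1_positive[OF assms] by (metis less_irrefl of_real_eq_0_iff)

section \<open>Source, range and phase in terms of one nonzero value\<close>

context
  fixes \<phi> v assumes \<phi>: "\<phi> \<in> E1 D F" and v: "v \<in> N" and nz: "\<phi> v \<noteq> 0"
begin

text \<open>The representing normalizer disappears: \<open>v\<close> is any normalizer with
  \<open>\<phi> v \<noteq> 0\<close>, so these formulas hold with the same \<open>v\<close> on an
  open set of functionals.\<close>

lemma src_weight: "weight (E1_src D F \<phi>) v = (cmod (\<phi> v))\<^sup>2"
  and E1_eq_bracket: "\<phi> x = sgn (\<phi> v) * bracket v (E1_src D F \<phi>) x"
  and src_eq: "E1_src D F \<phi> x = \<phi> (v * x) / \<phi> v"
  and rng_eq: "E1_rng D F \<phi> x = \<phi> (x * v) / \<phi> v"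
proof -
  obtain u f where u: "u \<in> N" "f \<in> F" "weight f u \<noteq> 0" and \<phi>_eq: "\<phi> = bracket u f"
    using E1_cases[OF \<phi>] .
  have s: "E1_src D F \<phi> = f" and r: "E1_rng D F \<phi> = translate u f"
    using u by (simp_all add: \<phi>_eq E1_src_bracket E1_rng_bracket)
  note nz' = nz[unfolded \<phi>_eq]
  show "weight (E1_src D F \<phi>) v = (cmod (\<phi> v))\<^sup>2" "\<phi> x = sgn (\<phi> v) * bracket v (E1_src D F \<phi>) x"
    unfolding s unfolding \<phi>_eq by (fact bracket_weight[OF u(2,1) v nz'])+
  show "E1_src D F \<phi> x = \<phi> (v * x) / \<phi> v" "E1_rng D F \<phi> x = \<phi> (x * v) / \<phi> v"
    unfolding s r unfolding \<phi>_eq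
    using nz' by (simp_all add: bracket_mult_right[OF u(2,1) v nz'] bracket_mult_left[OF u(2,1) v nz'])
qed

lemma src_weight_nonzero: "weight (E1_src D F \<phi>) v \<noteq> 0"
  using nz by (simp add: src_weight)

lemma rng_eq_translate: "E1_rng D F \<phi> = translate v (E1_src D F \<phi>)"
proof
  fix x
  let ?f = "E1_src D F \<phi>"
  have f: "?f \<in> F" using \<phi> by (rule src_in_F)
  have b: "bracket v ?f v \<noteq> 0" using src_weight_nonzero by (simp add: bracket_self[OF f])
  have "E1_rng D F \<phi> x = \<phi> (x * v) / \<phi> v" by (rule rng_eq)
  \<comment> \<open>The phase \<open>sgn (\<phi> v)\<close> is common to numerator and denominator
    and cancels.\<close>
  also have "\<dots> = bracket v ?f (x * v) / bracket v ?f v"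
    using E1_eq_bracket[of "x * v"] E1_eq_bracket[of v] nz by (metis mult_divide_mult_cancel_left_if mult_eq_0_iff)
  also have "\<dots> = translate v ?f x"
    using b by (simp add: bracket_mult_left[OF f v v b])
  finally show "E1_rng D F \<phi> x = translate v ?f x" .
qed

end

lemma E1_eq_bracket_positive:
  assumes "\<phi> \<in> E1 D F" "v \<in> N" "\<phi> v = of_real c" "0 < c"
  shows "\<phi> = bracket v (E1_src D F \<phi>)"
  using E1_eq_bracket[OF assms(1,2)] assms(3,4) by (auto simp: sgn_eq)

text \<open>A bracket is conjugate linear in its normalizer before normalization, so the circle
  action by \<open>z\<close> is realized on representatives by the scalar
  \<open>cnj z\<close>.\<close>

lemma bracket_act:
  assumes f: "f \<in> F" and z: "z \<in> circle"
  shows "weight f (cnj z *\<^sub>C v) = weight f v"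
    and "bracket (cnj z *\<^sub>C v) f = E1_act z (bracket v f)"
    and "translate (cnj z *\<^sub>C v) f = translate v f"
proof -
  have zz: "z * cnj z = 1" "cnj z * z = 1" using z by (simp_all flip: complex_norm_square add: mult.commute[of "cnj z"])
  have e: "star (cnj z *\<^sub>C v) * x * (cnj z *\<^sub>C v) = star v * x * v" for x
    by (simp add: star_scaleC scaleC_mult_left scaleC_mult_right scaleC_scaleC zz)
  from e[of 1] have e1: "star (cnj z *\<^sub>C v) * (cnj z *\<^sub>C v) = star v * v" by simp
  show "weight f (cnj z *\<^sub>C v) = weight f v" by (simp add: e1)
  show "bracket (cnj z *\<^sub>C v) f = E1_act z (bracket v f)"
    by (rule ext) (simp add: bracket_eq[OF f] e1 E1_act_def, simp add: star_scaleC scaleC_mult_left scaleC_mult_right)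
  show "translate (cnj z *\<^sub>C v) f = translate v f"
    by (simp add: translate_def e e1)
qed

lemma E1_act_in_E1: "\<lbrakk>\<phi> \<in> E1 D F; z \<in> circle\<rbrakk> \<Longrightarrow> E1_act z \<phi> \<in> E1 D F"
  and src_act: "\<lbrakk>\<phi> \<in> E1 D F; z \<in> circle\<rbrakk> \<Longrightarrow> E1_src D F (E1_act z \<phi>) = E1_src D F \<phi>"
  and rng_act: "\<lbrakk>\<phi> \<in> E1 D F; z \<in> circle\<rbrakk> \<Longrightarrow> E1_rng D F (E1_act z \<phi>) = E1_rng D F \<phi>"
  by (auto elim!: E1_cases simp del: mem_sphere_0
      simp: bracket_in_E1 E1_src_bracket E1_rng_bracket N_scaleC bracket_act simp flip: bracket_act(2))

text \<open>The key identity is \<open>translate v f (v * x) = f (x * v)\<close>: on the left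
  \<open>star v * v\<close> comes out of \<open>f\<close> as a scalar and cancels the
  denominator.\<close>

lemma E1_inv_bracket:
  assumes f: "f \<in> F" and v: "v \<in> N" and nz: "weight f v \<noteq> 0"
  shows "E1_inv (bracket v f) = bracket (star v) (translate v f)"
    and "weight (translate v f) (star v) = weight f v"
proof -
  note g = translate_F[OF f v nz]
  show w: "weight (translate v f) (star v) = weight f v"
    using translate_self_weight[OF f v nz] by simp
  have "E1_inv (bracket v f) x = bracket (star v) (translate v f) x" for x
  proof -
    have vv: "f (star v * v) \<noteq> 0" using nz by auto
    have "translate v f (v * x) = f (star v * v * (x * v)) / f (star v * v)"
      by (simp add: translate_def mult.assoc)
    also have "\<dots> = f (x * v)"
      using vv by (simp add: F_D_left[OF f N_star_mult[OF v]])
    finally have t: "translate v f (v * x) = f (x * v)" .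
    have "cnj (f (star v * star x)) = f (x * v)"
      using state_star[OF F_state[OF f], of "star v * star x"] by (simp add: star_mult)
    then have "E1_inv (bracket v f) x = f (x * v) / of_real (sqrt (weight f v))"
      by (simp add: E1_inv_def bracket_eq[OF f])
    also have "\<dots> = bracket (star v) (translate v f) x"
      unfolding bracket_eq[OF g] w by (simp add: t)
    finally show ?thesis .
  qed
  then show "E1_inv (bracket v f) = bracket (star v) (translate v f)" by blast
qed

lemma translate_star_translate:
  assumes f: "f \<in> F" and v: "v \<in> N" and nz: "weight f v \<noteq> 0"
  shows "translate (star v) (translate v f) = f"
  unfolding translate_translate[OF f v nz]
  by (rule translate_D) (use assms N_star_mult in auto)

lemma inv_in_E1: "\<phi> \<in> E1 D F \<Longrightarrow> E1_inv \<phi> \<in> E1 D F"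
  and src_E1_inv: "\<phi> \<in> E1 D F \<Longrightarrow> E1_src D F (E1_inv \<phi>) = E1_rng D F \<phi>"
  and rng_E1_inv: "\<phi> \<in> E1 D F \<Longrightarrow> E1_rng D F (E1_inv \<phi>) = E1_src D F \<phi>"
  by (auto elim!: E1_cases simp: E1_inv_bracket bracket_in_E1 translate_F N_star
      E1_src_bracket E1_rng_bracket translate_star_translate translate_self_weight)

text \<open>Weights multiply along a composable pair, so the square roots match. For the second
  formula, evaluating \<open>[u, translate v f]\<close> at \<open>x * star w\<close> produces the
  factor \<open>star w * v\<close> at the right end inside \<open>f\<close>, where it splits off;
  the result is \<open>[u * v, f](x)\<close> times the conjugate of
  \<open>[v, f](w)\<close>.\<close>

lemma bracket_product:
  assumes f: "f \<in> F" and v: "v \<in> N" and fv: "weight f v \<noteq> 0"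
    and u: "u \<in> N" and gu: "weight (translate v f) u \<noteq> 0"
  shows "weight f (u * v) = weight (translate v f) u * weight f v"
    and "\<lbrakk>w \<in> N; bracket v f w \<noteq> 0\<rbrakk> \<Longrightarrow>
      bracket (u * v) f x = bracket u (translate v f) (x * star w) / cnj (bracket v f w)"
proof -
  let ?g = "translate v f"
  note g = translate_F[OF f v fv]
  show uv: "weight f (u * v) = weight ?g u * weight f v"
    using fv by (simp add: weight_translate[OF f v])
  assume w: "w \<in> N" and "bracket v f w \<noteq> 0"
  then have "f (star v * w) \<noteq> 0" by (auto simp: bracket_eq[OF f])
  then have nz: "f (star w * v) \<noteq> 0" using F_star_swap[OF f, of w v] by simp
  have "?g (star u * (x * star w)) = f (star v * star u * x * (star w * v)) / f (star v * v)"
    by (simp add: translate_def mult.assoc)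
  also have "\<dots> = f (star v * star u * x) * f (star w * v) / of_real (weight f v)"
    using F_N_right[OF f _ nz] F_weight[OF f, of v] by (simp add: N_mult N_star v w)
  finally have "bracket u ?g (x * star w)
      = f (star (u * v) * x) * f (star w * v) / (of_real (weight f v) * of_real (sqrt (weight ?g u)))"
    by (simp add: bracket_eq[OF g] star_mult)
  also have "complex_of_real (weight f v) * of_real (sqrt (weight ?g u))
      = of_real (sqrt (weight f (u * v))) * of_real (sqrt (weight f v))"
    unfolding uv real_sqrt_mult using F_weight_nonneg[OF f, of v]
    by (simp flip: of_real_mult)
  also have "f (star w * v) = cnj (bracket v f w) * of_real (sqrt (weight f v))"
    unfolding bracket_eq[OF f] using fv F_star_swap[OF f, of w v] by simp
  finally show "bracket (u * v) f x = bracket u ?g (x * star w) / cnj (bracket v f w)"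
    using fv \<open>bracket v f w \<noteq> 0\<close> by (simp add: bracket_eq[OF f, of "u * v"])
qed

text \<open>This contains the well-definedness of the product: the description ranges over all pairs
  of normalizers at which the two functionals are positive, and all of them must give the same
  bracket.\<close>

lemma E1_mult_bracket:
  assumes f: "f \<in> F" and v: "v \<in> N" and fv: "weight f v \<noteq> 0"
    and u: "u \<in> N" and gu: "weight (translate v f) u \<noteq> 0"
  shows "E1_mult D F (bracket u (translate v f)) (bracket v f) = bracket (u * v) f"
proof -
  let ?g = "translate v f" let ?\<phi> = "bracket u ?g" let ?\<psi> = "bracket v f"
  note g = translate_F[OF f v fv]
  have in_E1: "?\<phi> \<in> E1 D F" "?\<psi> \<in> E1 D F" using assms g by (simp_all add: bracket_in_E1)
  have s: "E1_src D F ?\<psi> = f" "E1_rng D F ?\<psi> = ?g" "E1_src D F ?\<phi> = ?g"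
    using assms g by (simp_all add: E1_src_bracket E1_rng_bracket)
  have nz: "?\<psi> v \<noteq> 0" using fv by (simp add: bracket_self[OF f])
  show ?thesis unfolding E1_mult_def s
  proof (rule the_equality)
    have "0 < weight f v" "0 < weight ?g u"
      using fv gu F_weight_nonneg[OF f, of v] F_weight_nonneg[OF g, of u] by simp_all
    then show "\<exists>v1\<in>N. \<exists>v2\<in>N. ?\<phi> v1 \<in> \<real> \<and> 0 < Re (?\<phi> v1) \<and> ?\<psi> v2 \<in> \<real> \<and> 0 < Re (?\<psi> v2) \<and>
        bracket (u * v) f = bracket (v1 * v2) f"
      using u v by (intro bexI[of _ u] bexI[of _ v]) (simp_all add: bracket_self f g)
  next
    fix \<theta> assume "\<exists>v1\<in>N. \<exists>v2\<in>N. ?\<phi> v1 \<in> \<real> \<and> 0 < Re (?\<phi> v1) \<and> ?\<psi> v2 \<in> \<real> \<and> 0 < Re (?\<psi> v2) \<and>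
        \<theta> = bracket (v1 * v2) f"
    then obtain v1 v2 where v12: "v1 \<in> N" "v2 \<in> N" and \<theta>: "\<theta> = bracket (v1 * v2) f"
      and p: "?\<phi> v1 \<in> \<real>" "0 < Re (?\<phi> v1)" "?\<psi> v2 \<in> \<real>" "0 < Re (?\<psi> v2)" by blast
    have nz12: "?\<phi> v1 \<noteq> 0" "?\<psi> v2 \<noteq> 0" using p by auto
    \<comment> \<open>At a positive value the phase is 1, so the competing normalizers represent the
      same two functionals.\<close>
    have b: "?\<phi> = bracket v1 ?g" "?\<psi> = bracket v2 f"
      using E1_eq_bracket_positive[OF in_E1(1) v12(1) of_real_Re[OF p(1), symmetric] p(2)]
        E1_eq_bracket_positive[OF in_E1(2) v12(2) of_real_Re[OF p(3), symmetric] p(4)]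
      by (simp_all add: s)
    have t: "translate v2 f = ?g"
      using rng_eq_translate[OF in_E1(2) v12(2) nz12(2)] s by simp
    have w: "weight f v2 \<noteq> 0" "weight (translate v2 f) v1 \<noteq> 0"
      using src_weight_nonzero[OF in_E1(2) v12(2) nz12(2)]
        src_weight_nonzero[OF in_E1(1) v12(1) nz12(1)] by (simp_all add: s t)
    show "\<theta> = bracket (u * v) f"
    proof
      fix x
      \<comment> \<open>With the same test normalizer \<open>v\<close> for both products,
        \<open>bracket_product\<close> expresses each through the functionals alone.\<close>
      have "\<theta> x = bracket v1 (translate v2 f) (x * star v) / cnj (bracket v2 f v)"
        unfolding \<theta> using nz b(2) by (intro bracket_product f v12 w v) simp
      also have "\<dots> = ?\<phi> (x * star v) / cnj (?\<psi> v)" unfolding t by (simp flip: b)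
      also have "\<dots> = bracket (u * v) f x"
        by (rule bracket_product(2)[symmetric]) (fact assms nz)+
      finally show "\<theta> x = bracket (u * v) f x" .
    qed
  qed
qed

lemma E1_composable_cases:
  assumes "\<phi> \<in> E1 D F" "\<psi> \<in> E1 D F" "E1_src D F \<phi> = E1_rng D F \<psi>"
  obtains u v f where "u \<in> N" "v \<in> N" "f \<in> F" "weight f v \<noteq> 0" "weight (translate v f) u \<noteq> 0"
    "\<phi> = bracket u (translate v f)" "\<psi> = bracket v f"
proof -
  obtain u g where u: "u \<in> N" "g \<in> F" "weight g u \<noteq> 0" "\<phi> = bracket u g"
    using E1_cases[OF assms(1)] .
  obtain v f where v: "v \<in> N" "f \<in> F" "weight f v \<noteq> 0" "\<psi> = bracket v f"
    using E1_cases[OF assms(2)] .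
  have "g = translate v f" using assms(3) u v by (simp add: E1_src_bracket E1_rng_bracket)
  with u v that show ?thesis by simp
qed

context
  fixes \<phi> \<psi> assumes \<phi>: "\<phi> \<in> E1 D F" and \<psi>: "\<psi> \<in> E1 D F" and comp: "E1_src D F \<phi> = E1_rng D F \<psi>"
begin

lemma E1_mult_eq:
  assumes "w \<in> N" "\<psi> w \<noteq> 0"
  shows "E1_mult D F \<phi> \<psi> x = \<phi> (x * star w) / cnj (\<psi> w)"
proof -
  from \<phi> \<psi> comp obtain u v f where *: "u \<in> N" "v \<in> N" "f \<in> F" "weight f v \<noteq> 0" "weight (translate v f) u \<noteq> 0"
    "\<phi> = bracket u (translate v f)" "\<psi> = bracket v f" by (rule E1_composable_cases)
  then show ?thesis using assms by (simp add: E1_mult_bracket bracket_product(2)[of f v u w])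
qed

lemma mult_in_E1: "E1_mult D F \<phi> \<psi> \<in> E1 D F"
  and src_E1_mult: "E1_src D F (E1_mult D F \<phi> \<psi>) = E1_src D F \<psi>"
  and rng_E1_mult: "E1_rng D F (E1_mult D F \<phi> \<psi>) = E1_rng D F \<phi>"
proof -
  from \<phi> \<psi> comp obtain u v f where *: "u \<in> N" "v \<in> N" "f \<in> F" "weight f v \<noteq> 0" "weight (translate v f) u \<noteq> 0"
    "\<phi> = bracket u (translate v f)" "\<psi> = bracket v f" by (rule E1_composable_cases)
  have "weight f (u * v) \<noteq> 0" using * by (simp add: bracket_product(1))
  with * show "E1_mult D F \<phi> \<psi> \<in> E1 D F" "E1_src D F (E1_mult D F \<phi> \<psi>) = E1_src D F \<psi>"
    "E1_rng D F (E1_mult D F \<phi> \<psi>) = E1_rng D F \<phi>"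
    by (simp_all add: E1_mult_bracket bracket_in_E1 N_mult E1_src_bracket E1_rng_bracket translate_F
        translate_translate)
qed

end

lemma E1_mult_act:
  assumes "\<phi> \<in> E1 D F" "\<psi> \<in> E1 D F" "E1_src D F \<phi> = E1_rng D F \<psi>" "z \<in> circle" "w \<in> circle"
  shows "E1_mult D F (E1_act z \<phi>) (E1_act w \<psi>) = E1_act (z * w) (E1_mult D F \<phi> \<psi>)"
proof
  fix x
  obtain v where v: "v \<in> N" "\<psi> v \<noteq> 0" using E1_nonzero[OF assms(2)] .
  have w: "w * cnj w = 1" "w \<noteq> 0" using assms(5) by (auto simp flip: complex_norm_square)
  have nz: "E1_act w \<psi> v \<noteq> 0" using assms v w by (simp add: E1_act_eq)
  have "E1_mult D F (E1_act z \<phi>) (E1_act w \<psi>) x = E1_act z \<phi> (x * star v) / cnj (E1_act w \<psi> v)"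
    using assms v nz by (intro E1_mult_eq) (simp_all add: E1_act_in_E1 src_act rng_act)
  also have "\<dots> = (z / cnj w) * (\<phi> (x * star v) / cnj (\<psi> v))"
    using assms by (simp add: E1_act_eq)
  \<comment> \<open>On the circle the inverse of \<open>cnj w\<close> is \<open>w\<close>, so the
    conjugate in the denominator becomes multiplication by \<open>w\<close>.\<close>
  also have "z / cnj w = z * w" using w by (simp add: field_simps)
  finally show "E1_mult D F (E1_act z \<phi>) (E1_act w \<psi>) x = E1_act (z * w) (E1_mult D F \<phi> \<psi>) x"
    using assms v by (simp add: E1_mult_eq E1_act_eq mult_in_E1)
qed

text \<open>Once the three functionals are represented over the single source state
  \<open>f\<close>, both sides are the bracket of \<open>t * u * v\<close>.\<close>

lemma E1_mult_assoc:
  assumes \<phi>: "\<phi> \<in> E1 D F" and \<psi>: "\<psi> \<in> E1 D F" and \<theta>: "\<theta> \<in> E1 D F"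
    and c: "E1_src D F \<phi> = E1_rng D F \<psi>" "E1_src D F \<psi> = E1_rng D F \<theta>"
  shows "E1_mult D F (E1_mult D F \<phi> \<psi>) \<theta> = E1_mult D F \<phi> (E1_mult D F \<psi> \<theta>)"
proof -
  from \<psi> \<theta> c(2) obtain u v f where *: "u \<in> N" "v \<in> N" "f \<in> F" "weight f v \<noteq> 0" "weight (translate v f) u \<noteq> 0"
    "\<psi> = bracket u (translate v f)" "\<theta> = bracket v f" by (rule E1_composable_cases)
  obtain t g where t: "t \<in> N" "g \<in> F" "weight g t \<noteq> 0" "\<phi> = bracket t g"
    using E1_cases[OF \<phi>] .
  have f': "translate v f \<in> F" using * by (simp add: translate_F)
  have uv: "weight f (u * v) \<noteq> 0" using * by (simp add: bracket_product(1))
  have g: "g = translate u (translate v f)" "g = translate (u * v) f"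
    using c(1) * t f' by (simp_all add: E1_src_bracket E1_rng_bracket translate_translate)
  have tu: "weight (translate v f) (t * u) \<noteq> 0"
    using bracket_product(1)[OF f' *(1) *(5) t(1)] t g * by simp
  have "E1_mult D F \<phi> \<psi> = bracket (t * u) (translate v f)"
    unfolding t(4) g(1) *(6) using f' * t g by (intro E1_mult_bracket) auto
  then have 1: "E1_mult D F (E1_mult D F \<phi> \<psi>) \<theta> = bracket (t * u * v) f"
    using * t tu by (simp add: E1_mult_bracket N_mult)
  have "E1_mult D F \<psi> \<theta> = bracket (u * v) f"
    using * by (simp add: E1_mult_bracket)
  moreover have "E1_mult D F (bracket t (translate (u * v) f)) (bracket (u * v) f) = bracket (t * (u * v)) f"
    using * t g uv by (intro E1_mult_bracket) (auto simp: N_mult)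
  ultimately show ?thesis using 1 t(4) g(2) by (simp add: mult.assoc)
qed

lemma E1_mult_src: "\<phi> \<in> E1 D F \<Longrightarrow> E1_mult D F \<phi> (E1_src D F \<phi>) = \<phi>"
proof (rule ext)
  fix x assume \<phi>: "\<phi> \<in> E1 D F"
  note s = src_in_F[OF \<phi>]
  have "E1_mult D F \<phi> (E1_src D F \<phi>) x = \<phi> (x * star 1) / cnj (E1_src D F \<phi> 1)"
    using \<phi> s F_subset_E1 by (intro E1_mult_eq) (auto simp: E1_rng_F N_one state_one[OF F_state[OF s]])
  then show "E1_mult D F \<phi> (E1_src D F \<phi>) x = \<phi> x" by (simp add: state_one[OF F_state[OF s]])
qed

lemma E1_mult_inv: "\<phi> \<in> E1 D F \<Longrightarrow> E1_mult D F \<phi> (E1_inv \<phi>) = E1_rng D F \<phi>"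
proof (rule ext)
  fix x assume \<phi>: "\<phi> \<in> E1 D F"
  obtain v where v: "v \<in> N" "\<phi> v \<noteq> 0" using E1_nonzero[OF \<phi>] .
  \<comment> \<open>With test normalizer \<open>star v\<close> the product formula becomes
    \<open>\<phi> (x * v) / \<phi> v\<close>, which is the range.\<close>
  have nz: "E1_inv \<phi> (star v) \<noteq> 0" using v by (simp add: E1_inv_def)
  have "E1_mult D F \<phi> (E1_inv \<phi>) x = \<phi> (x * star (star v)) / cnj (E1_inv \<phi> (star v))"
    using \<phi> v nz by (intro E1_mult_eq) (auto simp: inv_in_E1 rng_E1_inv N_star)
  then show "E1_mult D F \<phi> (E1_inv \<phi>) x = E1_rng D F \<phi> x"
    using \<phi> v by (simp add: E1_inv_def rng_eq)
qed

lemma E1_inv_inv: "E1_inv (E1_inv \<phi>) = \<phi>"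
  by (simp add: E1_inv_def)

lemma E1_inv_mult: "\<phi> \<in> E1 D F \<Longrightarrow> E1_mult D F (E1_inv \<phi>) \<phi> = E1_src D F \<phi>"
  using E1_mult_inv[of "E1_inv \<phi>"] by (simp add: inv_in_E1 rng_E1_inv E1_inv_inv)

lemma E1_rng_mult: "\<phi> \<in> E1 D F \<Longrightarrow> E1_mult D F (E1_rng D F \<phi>) \<phi> = \<phi>"
  using E1_mult_assoc[of \<phi> "E1_inv \<phi>" \<phi>]
  by (simp add: E1_mult_inv E1_inv_mult E1_mult_src inv_in_E1 src_E1_inv rng_E1_inv)

section \<open>Groupoid axioms for the normalized functionals\<close>

lemma arrows_E1: "arrows (E1_groupoid D F) = E1 D F"
  by (simp add: arrows_def E1_groupoid_def)

lemma composable_E1: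
  "composable (E1_groupoid D F) = {(\<phi>, \<psi>). \<phi> \<in> E1 D F \<and> \<psi> \<in> E1 D F \<and> E1_src D F \<phi> = E1_rng D F \<psi>}"
  by (simp add: composable_def arrows_E1) (simp add: E1_groupoid_def)

lemma groupoid_E1: "groupoid (E1_groupoid D F)"
proof
  fix g h k
  let ?G = "E1_groupoid D F"
  note simps = E1_groupoid_def F_subset_E1[THEN subsetD] src_in_F rng_in_F E1_src_F E1_rng_F
    mult_in_E1 src_E1_mult rng_E1_mult inv_in_E1 src_E1_inv rng_E1_inv E1_mult_src E1_rng_mult E1_inv_mult E1_mult_inv
  show "gsrc ?G g \<in> arrows ?G" "grng ?G g \<in> arrows ?G" "gsrc ?G (gsrc ?G g) = gsrc ?G g"
    "grng ?G (gsrc ?G g) = gsrc ?G g" "gsrc ?G (grng ?G g) = grng ?G g" "grng ?G (grng ?G g) = grng ?G g"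
    "gmult ?G g (gsrc ?G g) = g" "gmult ?G (grng ?G g) g = g" "ginv ?G g \<in> arrows ?G"
    "gsrc ?G (ginv ?G g) = grng ?G g" "grng ?G (ginv ?G g) = gsrc ?G g"
    "gmult ?G (ginv ?G g) g = gsrc ?G g" "gmult ?G g (ginv ?G g) = grng ?G g"
    if "g \<in> arrows ?G"
    using that unfolding arrows_E1 by (simp_all add: simps)
  show "gmult ?G g h \<in> arrows ?G" "gsrc ?G (gmult ?G g h) = gsrc ?G h" "grng ?G (gmult ?G g h) = grng ?G g"
    if "(g, h) \<in> composable ?G"
    using that unfolding arrows_E1 composable_E1 by (simp_all add: simps)
  show "gmult ?G (gmult ?G g h) k = gmult ?G g (gmult ?G h k)"
    if "(g, h) \<in> composable ?G" "(h, k) \<in> composable ?G"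
    using that unfolding composable_E1 by (simp add: E1_groupoid_def E1_mult_assoc)
qed

end

section \<open>Topology\<close>

text \<open>The product formulas depend on a test normalizer and hold only where the second factor
  does not vanish at it, so continuity must be glued from such open sets.\<close>

lemma continuous_on_local:
  assumes "\<And>x. x \<in> S \<Longrightarrow> \<exists>U. open U \<and> x \<in> U \<and> continuous_on (S \<inter> U) f"
  shows "continuous_on S f"
proof -
  have "(f \<longlongrightarrow> f x) (at x within S)" if x: "x \<in> S" for x
  proof -
    obtain U where U: "open U" "x \<in> U" "continuous_on (S \<inter> U) f"
      using assms[OF x] by blast
    then have "(f \<longlongrightarrow> f x) (at x within (S \<inter> U))"
      using x by (simp add: continuous_on_def)
    moreover have "at x within S \<inter> U = at x within S"
      using U by (intro at_within_nhd[of x U]) auto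
    ultimately show ?thesis by simp
  qed
  then show ?thesis by (simp add: continuous_on_def)
qed

lemma continuous_on_eval:
  "continuous_on S g \<Longrightarrow> continuous_on S (\<lambda>p. (g p :: 'b \<Rightarrow> 'c::topological_space) y)"
  by (rule continuous_on_product_then_coordinatewise)

lemmas continuous_on_evals [continuous_intros] =
  continuous_on_eval[OF continuous_on_id] continuous_on_eval[OF continuous_on_fst[OF continuous_on_id]]
  continuous_on_eval[OF continuous_on_snd[OF continuous_on_id]]

lemma open_eval_neq: "open {k::'b \<Rightarrow> 'c::t1_space. k v \<noteq> c}"
proof -
  have "{k. k v \<noteq> c} = (\<lambda>k::'b \<Rightarrow> 'c. k v) -` (- {c})" by auto
  then show ?thesis by (simp only:) (intro open_vimage open_Compl closed_singleton continuous_on_product_coordinates)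
qed

lemma Hausdorff_space_fun: "Hausdorff_space (euclidean :: ('b \<Rightarrow> 'c::metric_space) topology)"
proof -
  have "Hausdorff_space (product_topology (\<lambda>i::'b. euclidean :: 'c topology) UNIV)"
    unfolding Hausdorff_space_product_topology by simp
  then show ?thesis by (simp only: euclidean_product_topology)
qed

lemma homeomorphic_map_top_of_setI:
  assumes "continuous_on A f" "continuous_on B g"
    and "\<And>x. x \<in> A \<Longrightarrow> f x \<in> B \<and> g (f x) = x" and "\<And>y. y \<in> B \<Longrightarrow> g y \<in> A \<and> f (g y) = y"
  shows "homeomorphic_map (top_of_set A) (top_of_set B) f"
  unfolding homeomorphic_map_maps homeomorphic_maps_def using assms by (intro exI[of _ g]) auto

lemma subtopology_prod_top_of_set:
  assumes "S \<subseteq> A \<times> B"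
  shows "subtopology (prod_topology (top_of_set A) (top_of_set B)) S = top_of_set S"
  using assms by (simp add: subtopology_subtopology inf.absorb2 flip: subtopology_Times)

text \<open>The range is the source composed with inversion; this lemma carries the local
  homeomorphism property from one to the other.\<close>

lemma local_homeomorphism_map_compose:
  assumes f: "local_homeomorphism_map X Y f" and i: "homeomorphic_map X X i"
    and g: "\<And>x. x \<in> topspace X \<Longrightarrow> g x = f (i x)"
  shows "local_homeomorphism_map X Y g"
  unfolding local_homeomorphism_map_def
proof
  fix x assume x: "x \<in> topspace X"
  have surj: "i ` topspace X = topspace X" using i by (rule homeomorphic_imp_surjective_map)
  then have "i x \<in> topspace X" using x by blast
  then obtain U where U: "openin X U" "i x \<in> U" "openin Y (f ` U)"
      "homeomorphic_map (subtopology X U) (subtopology Y (f ` U)) f"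
    using f unfolding local_homeomorphism_map_def by blast
  define U' where "U' = {y \<in> topspace X. i y \<in> U}"
  have op: "openin X U'" unfolding U'_def
    using homeomorphic_imp_continuous_map[OF i] U(1) by (rule openin_continuous_map_preimage)
  have "U \<subseteq> topspace X" using U(1) by (rule openin_subset)
  have iU: "i ` U' = U"
  proof
    show "i ` U' \<subseteq> U" by (auto simp: U'_def)
    show "U \<subseteq> i ` U'"
    proof
      fix y assume "y \<in> U"
      then have "y \<in> i ` topspace X" using \<open>U \<subseteq> topspace X\<close> surj by auto
      then show "y \<in> i ` U'" using \<open>y \<in> U\<close> by (auto simp: U'_def)
    qed
  qed
  have gU: "g ` U' = f ` U"
  proof -
    have "g ` U' = f ` i ` U'" unfolding image_image U'_def using g by (intro image_cong) auto
    with iU show ?thesis by simp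
  qed
  have "homeomorphic_map (subtopology X U') (subtopology X U) i"
    using i iU \<open>U \<subseteq> topspace X\<close> openin_subset[OF op]
    by (intro homeomorphic_map_subtopologies) (auto simp: Int_absorb1)
  then have "homeomorphic_map (subtopology X U') (subtopology Y (f ` U)) (f \<circ> i)"
    using U(4) by (rule homeomorphic_map_compose)
  then have "homeomorphic_map (subtopology X U') (subtopology Y (g ` U')) g"
    unfolding gU by (rule homeomorphic_map_eq) (simp add: g)
  moreover have "x \<in> U'" using x U(2) by (simp add: U'_def)
  ultimately show "\<exists>U. openin X U \<and> x \<in> U \<and> openin Y (g ` U) \<and>
      homeomorphic_map (subtopology X U) (subtopology Y (g ` U)) g"
    using op U(3) gU by metis
qed

lemma continuous_on_modulus: "continuous_on S modulus"
  unfolding modulus_def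
  by (intro continuous_on_coordinatewise_then_product continuous_intros)

lemma continuous_on_unmodulus:
  assumes "\<And>x. continuous_on S (\<lambda>p. g p x)"
  shows "continuous_on S (\<lambda>p. unmodulus (g p))"
  unfolding unmodulus_def Complex_eq
  by (rule continuous_on_coordinatewise_then_product) (auto intro!: continuous_intros assms)

context invariant_state_set
begin

section \<open>Continuity and local compactness for the normalized functionals\<close>

lemma E1_sel [simp]:
  "gtop (E1_groupoid D F) = top_of_set (E1 D F)" "gsrc (E1_groupoid D F) = E1_src D F"
  "grng (E1_groupoid D F) = E1_rng D F" "gmult (E1_groupoid D F) = E1_mult D F"
  "ginv (E1_groupoid D F) = E1_inv"
  by (simp_all add: E1_groupoid_def)

lemma unit_space_E1: "unit_space (E1_groupoid D F) = F"
proof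
  show "unit_space (E1_groupoid D F) \<subseteq> F"
    by (auto simp: unit_space_def arrows_E1 src_in_F)
  show "F \<subseteq> unit_space (E1_groupoid D F)"
  proof
    fix f assume "f \<in> F"
    then have "f = E1_src D F f" "f \<in> E1 D F" using E1_src_F F_subset_E1 by auto
    then show "f \<in> unit_space (E1_groupoid D F)" by (auto simp: unit_space_def arrows_E1)
  qed
qed

lemma topological_groupoid_E1: "topological_groupoid (E1_groupoid D F)"
proof -
  interpret groupoid "E1_groupoid D F" by (rule groupoid_E1)
  show ?thesis
  proof
    have "continuous_on (E1 D F) E1_inv" unfolding E1_inv_def
      by (intro continuous_on_coordinatewise_then_product continuous_intros)
    then show "continuous_map (gtop (E1_groupoid D F)) (gtop (E1_groupoid D F)) (ginv (E1_groupoid D F))"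
      by (auto simp: inv_in_E1)
  next
    let ?C = "composable (E1_groupoid D F)"
    have "continuous_on ?C (\<lambda>(g, h). E1_mult D F g h)"
    proof (rule continuous_on_local, clarsimp)
      fix \<phi> \<psi> assume "(\<phi>, \<psi>) \<in> ?C"
      then obtain v where v: "v \<in> N" "\<psi> v \<noteq> 0" using E1_nonzero[of \<psi>] by (auto simp: composable_E1)
      let ?U = "(UNIV :: ('a \<Rightarrow> complex) set) \<times> {\<psi>. \<psi> v \<noteq> (0::complex)}"
      have "continuous_on (?C \<inter> ?U) (\<lambda>p x. fst p (x * star v) / cnj (snd p v))"
        by (intro continuous_on_coordinatewise_then_product continuous_intros) auto
      then have "continuous_on (?C \<inter> ?U) (\<lambda>(g, h). E1_mult D F g h)"
        by (rule continuous_on_eq) (use v in \<open>auto simp: composable_E1 E1_mult_eq\<close>)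
      moreover have "open ?U" by (intro open_Times open_UNIV open_eval_neq)
      ultimately show "\<exists>U. open U \<and> (\<phi>, \<psi>) \<in> U \<and> continuous_on (?C \<inter> U) (\<lambda>(g, h). E1_mult D F g h)"
        using v by (intro exI[of _ ?U]) auto
    qed
    then show "continuous_map (subtopology (prod_topology (gtop (E1_groupoid D F)) (gtop (E1_groupoid D F))) ?C)
        (gtop (E1_groupoid D F)) (\<lambda>(g, h). gmult (E1_groupoid D F) g h)"
      by (subst E1_sel subtopology_prod_top_of_set)+ (auto simp: composable_E1 mult_in_E1)
  qed
qed

lemma continuous_on_bracket:
  assumes "\<And>f. f \<in> S \<Longrightarrow> f \<in> F \<and> weight f v \<noteq> 0"
  shows "continuous_on (S \<times> T) (\<lambda>(f, z) x. z * bracket v f x)"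
proof -
  \<comment> \<open>The form with the real square root is used because \<open>csqrt\<close> is
    discontinuous across the negative axis.\<close>
  have "continuous_on (S \<times> T) (\<lambda>p x. snd p * (fst p (star v * x) / of_real (sqrt (weight (fst p) v))))"
    using assms by (intro continuous_on_coordinatewise_then_product continuous_intros) auto
  then show ?thesis
    by (rule continuous_on_eq) (use assms in \<open>auto simp: bracket_eq\<close>)
qed

text \<open>Since \<open>\<bar>\<phi> v\<bar>\<^sup>2\<close> is the weight of \<open>v\<close> at
  the source, the level set is the continuous image, under source and phase coordinates, of a closed
  part of \<open>F\<close> times the circle. The bound \<open>e\<close> keeps the denominators away
  from zero.\<close>

lemma compact_E1_level:
  assumes v: "v \<in> N" and e: "0 < e"
  shows "compact {\<phi> \<in> E1 D F. e \<le> cmod (\<phi> v)}"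
proof -
  define S where "S = F \<inter> {f. e\<^sup>2 \<le> weight f v}"
  have S: "f \<in> F \<and> weight f v \<noteq> 0" if "f \<in> S" for f
    using that e zero_less_power[of e 2] by (auto simp: S_def)
  have "closed {f::'a \<Rightarrow> complex. e\<^sup>2 \<le> weight f v}"
    by (intro closed_Collect_le continuous_intros)
  then have "compact S" unfolding S_def using F_compact by blast
  then have "compact (S \<times> circle)" by (intro compact_Times) simp_all
  then have "compact ((\<lambda>(f, z) x. z * bracket v f x) ` (S \<times> circle))"
    using continuous_on_bracket[OF S] compact_continuous_image by blast
  also have "(\<lambda>(f, z) x. z * bracket v f x) ` (S \<times> circle) = {\<phi> \<in> E1 D F. e \<le> cmod (\<phi> v)}"
  proof safe
    fix f z assume f: "f \<in> S" and z: "z \<in> circle"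
    have b: "bracket v f \<in> E1 D F" using S[OF f] v by (simp add: bracket_in_E1)
    have "(\<lambda>x. z * bracket v f x) = E1_act z (bracket v f)" using b by (simp add: E1_act_eq)
    then show "(\<lambda>x. z * bracket v f x) \<in> E1 D F" using b z by (simp add: E1_act_in_E1)
    have "e \<le> sqrt (weight f v)" using f e by (simp add: S_def real_le_rsqrt)
    then show "e \<le> cmod (z * bracket v f v)"
      using z S[OF f] e by (simp add: norm_mult bracket_self)
  next
    fix \<phi> assume \<phi>: "\<phi> \<in> E1 D F" and le: "e \<le> cmod (\<phi> v)"
    then have nz: "\<phi> v \<noteq> 0" using e by auto
    have "E1_src D F \<phi> \<in> S" using le e
      by (simp add: S_def src_in_F \<phi> src_weight[OF \<phi> v nz] power_mono)
    moreover have "sgn (\<phi> v) \<in> circle" using nz by (simp add: norm_sgn)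
    moreover have "\<phi> = (\<lambda>x. sgn (\<phi> v) * bracket v (E1_src D F \<phi>) x)"
      by (rule ext) (rule E1_eq_bracket[OF \<phi> v nz])
    ultimately show "\<phi> \<in> (\<lambda>(f, z) x. z * bracket v f x) ` (S \<times> circle)"
      by (intro rev_image_eqI[of "(E1_src D F \<phi>, sgn (\<phi> v))"]) simp_all
  qed
  finally show ?thesis .
qed

lemma lch_groupoid_E1: "lch_groupoid (E1_groupoid D F)"
proof -
  interpret topological_groupoid "E1_groupoid D F" by (rule topological_groupoid_E1)
  show ?thesis
  proof
    show "Hausdorff_space (gtop (E1_groupoid D F))"
      by (simp add: Hausdorff_space_fun Hausdorff_space_subtopology)
    have "\<exists>U K. openin (top_of_set (E1 D F)) U \<and> compactin (top_of_set (E1 D F)) K \<and> \<phi> \<in> U \<and> U \<subseteq> K"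
      if \<phi>: "\<phi> \<in> E1 D F" for \<phi>
    proof -
      obtain v where v: "v \<in> N" "\<phi> v \<noteq> 0" using E1_nonzero[OF \<phi>] .
      \<comment> \<open>Halving puts \<open>\<phi>\<close> in the open set given by the strict
        inequality, which lies in the compact level set.\<close>
      define e where "e = cmod (\<phi> v) / 2"
      have "open {\<phi>. e < cmod (\<phi> v)}" by (intro open_Collect_less continuous_intros)
      then have "openin (top_of_set (E1 D F)) (E1 D F \<inter> {\<phi>. e < cmod (\<phi> v)})" by blast
      moreover have "compactin (top_of_set (E1 D F)) {\<phi> \<in> E1 D F. e \<le> cmod (\<phi> v)}"
        using v compact_E1_level[of v e] by (auto simp: e_def compactin_subtopology)
      ultimately show ?thesis
        by (rule_tac exI, rule_tac exI, intro conjI) (assumption | use \<phi> v in \<open>auto simp: e_def\<close>)+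
    qed
    then show "locally_compact_space (gtop (E1_groupoid D F))"
      by (simp add: locally_compact_space_def)
  qed
qed

section \<open>The groupoid of absolute values\<close>

lemma R_gtop [simp]: "gtop (R_groupoid D F) = top_of_set (modulus ` E1 D F)"
  by (simp add: R_groupoid_def)

lemma arrows_R: "arrows (R_groupoid D F) = modulus ` E1 D F"
  by (simp add: arrows_def)

lemma modulus_act: "\<lbrakk>\<phi> \<in> E1 D F; z \<in> circle\<rbrakk> \<Longrightarrow> modulus (E1_act z \<phi>) = modulus \<phi>"
  by (auto simp: modulus_def E1_act_eq norm_mult)

lemma modulus_src:
  "\<lbrakk>\<phi> \<in> E1 D F; v \<in> N; \<phi> v \<noteq> 0\<rbrakk> \<Longrightarrow>
     modulus (E1_src D F \<phi>) = (\<lambda>x. modulus \<phi> (v * x) / modulus \<phi> v)"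
  by (auto simp: modulus_def src_eq norm_divide)

lemma modulus_F_inject: "\<lbrakk>f \<in> F; g \<in> F; modulus f = modulus g\<rbrakk> \<Longrightarrow> f = g"
  by (simp add: modulus_state_inject F_state)

text \<open>Equal absolute values have sources with equal absolute values, and states are determined
  by these. Both functionals are then phase multiples of one bracket.\<close>

lemma modulus_eqE:
  assumes \<phi>: "\<phi> \<in> E1 D F" and \<psi>: "\<psi> \<in> E1 D F" and eq: "modulus \<phi> = modulus \<psi>"
  obtains z where "z \<in> circle" "\<phi> = E1_act z \<psi>"
proof -
  obtain v where v: "v \<in> N" "\<phi> v \<noteq> 0" using E1_nonzero[OF \<phi>] .
  have "cmod (\<phi> v) = cmod (\<psi> v)" using eq by (simp add: modulus_def fun_eq_iff)
  then have v': "\<psi> v \<noteq> 0" using v(2) by auto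
  have "modulus (E1_src D F \<phi>) = modulus (E1_src D F \<psi>)"
    by (simp add: modulus_src[OF \<phi> v] modulus_src[OF \<psi> v(1) v'] eq)
  then have s: "E1_src D F \<phi> = E1_src D F \<psi>"
    using \<phi> \<psi> src_in_F modulus_F_inject by blast
  define z where "z = sgn (\<phi> v) / sgn (\<psi> v)"
  have nz: "sgn (\<psi> v) \<noteq> 0" using v' by (simp add: sgn_zero_iff)
  have "z \<in> circle" using v v' by (simp add: z_def norm_divide norm_sgn)
  moreover have "\<phi> x = E1_act z \<psi> x" for x
    using E1_eq_bracket[OF \<phi> v, of x] E1_eq_bracket[OF \<psi> v(1) v', of x] nz
    unfolding s E1_act_eq[OF \<psi>] z_def by simp
  ultimately show ?thesis using that by blast
qed

text \<open>Descent to absolute values: the description picks out a value as soon as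
  \<open>g\<close> is invariant under the circle action, since two functionals with the same modulus
  lie in one orbit.\<close>

lemma the_modulus:
  assumes \<phi>: "\<phi> \<in> E1 D F"
    and inv: "\<And>\<psi> z. \<lbrakk>\<psi> \<in> E1 D F; z \<in> circle; \<phi> = E1_act z \<psi>\<rbrakk> \<Longrightarrow> g \<psi> = g \<phi>"
  shows "(THE \<tau>. \<exists>\<psi>\<in>E1 D F. modulus \<phi> = modulus \<psi> \<and> \<tau> = g \<psi>) = g \<phi>"
proof (rule the_equality)
  show "\<exists>\<psi>\<in>E1 D F. modulus \<phi> = modulus \<psi> \<and> g \<phi> = g \<psi>" using \<phi> by blast
next
  fix \<tau> assume "\<exists>\<psi>\<in>E1 D F. modulus \<phi> = modulus \<psi> \<and> \<tau> = g \<psi>"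
  then obtain \<psi> where \<psi>: "\<psi> \<in> E1 D F" "modulus \<phi> = modulus \<psi>" and \<tau>: "\<tau> = g \<psi>" by blast
  obtain z where "z \<in> circle" "\<phi> = E1_act z \<psi>" using modulus_eqE[OF \<phi> \<psi>] .
  with \<psi>(1) show "\<tau> = g \<phi>" unfolding \<tau> by (rule inv)
qed

lemma R_src: "\<phi> \<in> E1 D F \<Longrightarrow> gsrc (R_groupoid D F) (modulus \<phi>) = modulus (E1_src D F \<phi>)"
  and R_rng: "\<phi> \<in> E1 D F \<Longrightarrow> grng (R_groupoid D F) (modulus \<phi>) = modulus (E1_rng D F \<phi>)"
proof -
  assume \<phi>: "\<phi> \<in> E1 D F"
  have "(THE \<tau>. \<exists>\<psi>\<in>E1 D F. modulus \<phi> = modulus \<psi> \<and> \<tau> = modulus (E1_src D F \<psi>)) = modulus (E1_src D F \<phi>)"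
    "(THE \<tau>. \<exists>\<psi>\<in>E1 D F. modulus \<phi> = modulus \<psi> \<and> \<tau> = modulus (E1_rng D F \<psi>)) = modulus (E1_rng D F \<phi>)"
    by (intro the_modulus[OF \<phi>]; clarify; metis src_act rng_act)+
  then show "gsrc (R_groupoid D F) (modulus \<phi>) = modulus (E1_src D F \<phi>)"
    "grng (R_groupoid D F) (modulus \<phi>) = modulus (E1_rng D F \<phi>)"
    unfolding R_groupoid_def groupoid_data.select_convs .
qed

lemma modulus_inv: "modulus (E1_inv \<phi>) = (\<lambda>x. modulus \<phi> (star x))"
  by (simp add: modulus_def E1_inv_def)

lemma R_inv:
  assumes \<phi>: "\<phi> \<in> E1 D F"
  shows "ginv (R_groupoid D F) (modulus \<phi>) = modulus (E1_inv \<phi>)"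
proof -
  have "(THE \<tau>. \<exists>\<psi>\<in>E1 D F. modulus \<phi> = modulus \<psi> \<and> \<tau> = modulus (E1_inv \<psi>)) = modulus (E1_inv \<phi>)"
    by (intro the_modulus[OF \<phi>]) (simp only: modulus_inv modulus_act)
  then show ?thesis unfolding R_groupoid_def groupoid_data.select_convs .
qed

lemma R_mult:
  assumes \<phi>: "\<phi> \<in> E1 D F" and \<psi>: "\<psi> \<in> E1 D F" and c: "E1_src D F \<phi> = E1_rng D F \<psi>"
  shows "gmult (R_groupoid D F) (modulus \<phi>) (modulus \<psi>) = modulus (E1_mult D F \<phi> \<psi>)"
proof -
  \<comment> \<open>The product has two representatives to vary. Changing them by phases
    \<open>z\<close> and \<open>w\<close> changes the product by \<open>z * w\<close>, which the
    modulus ignores.\<close>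
  have wd: "modulus (E1_mult D F \<phi>' \<psi>') = modulus (E1_mult D F \<phi> \<psi>)"
    if h: "\<phi>' \<in> E1 D F" "\<psi>' \<in> E1 D F" "modulus \<phi>' = modulus \<phi>" "modulus \<psi>' = modulus \<psi>" for \<phi>' \<psi>'
  proof -
    obtain z where z: "z \<in> circle" "\<phi>' = E1_act z \<phi>" using modulus_eqE[OF h(1) \<phi> h(3)] .
    obtain w where w: "w \<in> circle" "\<psi>' = E1_act w \<psi>" using modulus_eqE[OF h(2) \<psi> h(4)] .
    have "z * w \<in> circle" using z w by (simp add: norm_mult)
    then show ?thesis
      unfolding z(2) w(2) E1_mult_act[OF assms z(1) w(1)] by (rule modulus_act[OF mult_in_E1[OF assms]])
  qed
  show ?thesis unfolding R_groupoid_def groupoid_data.select_convs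
  proof (rule the_equality)
    fix \<tau> assume "\<exists>\<phi>'\<in>E1 D F. \<exists>\<psi>'\<in>E1 D F. modulus \<phi> = modulus \<phi>' \<and> modulus \<psi> = modulus \<psi>' \<and>
      E1_src D F \<phi>' = E1_rng D F \<psi>' \<and> \<tau> = modulus (E1_mult D F \<phi>' \<psi>')"
    then obtain \<phi>' \<psi>' where "\<phi>' \<in> E1 D F" "\<psi>' \<in> E1 D F" "modulus \<phi>' = modulus \<phi>"
      "modulus \<psi>' = modulus \<psi>" and \<tau>: "\<tau> = modulus (E1_mult D F \<phi>' \<psi>')" by metis
    then show "\<tau> = modulus (E1_mult D F \<phi> \<psi>)" unfolding \<tau> by (intro wd)
  next
    show "\<exists>\<phi>'\<in>E1 D F. \<exists>\<psi>'\<in>E1 D F. modulus \<phi> = modulus \<phi>' \<and> modulus \<psi> = modulus \<psi>' \<and>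
      E1_src D F \<phi>' = E1_rng D F \<psi>' \<and> modulus (E1_mult D F \<phi> \<psi>) = modulus (E1_mult D F \<phi>' \<psi>')"
      by (rule bexI[OF _ \<phi>], rule bexI[OF _ \<psi>]) (simp add: c)
  qed
qed

lemma composable_R_iff:
  assumes \<phi>: "\<phi> \<in> E1 D F" and \<psi>: "\<psi> \<in> E1 D F"
  shows "(modulus \<phi>, modulus \<psi>) \<in> composable (R_groupoid D F) \<longleftrightarrow> E1_src D F \<phi> = E1_rng D F \<psi>"
proof -
  have "(modulus \<phi>, modulus \<psi>) \<in> composable (R_groupoid D F) \<longleftrightarrow>
      modulus (E1_src D F \<phi>) = modulus (E1_rng D F \<psi>)"
    using imageI[OF \<phi>, of modulus] imageI[OF \<psi>, of modulus]
    by (simp add: composable_def arrows_R R_src R_rng \<phi> \<psi>)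
  then show ?thesis using modulus_F_inject[OF src_in_F[OF \<phi>] rng_in_F[OF \<psi>]] by metis
qed

lemma composable_RE:
  assumes "(g, h) \<in> composable (R_groupoid D F)"
  obtains \<phi> \<psi> where "\<phi> \<in> E1 D F" "\<psi> \<in> E1 D F" "E1_src D F \<phi> = E1_rng D F \<psi>"
    "g = modulus \<phi>" "h = modulus \<psi>"
proof -
  have "g \<in> modulus ` E1 D F" "h \<in> modulus ` E1 D F"
    using assms by (auto simp: composable_def arrows_R)
  then show ?thesis using that assms composable_R_iff by blast
qed

lemma groupoid_R: "groupoid (R_groupoid D F)"
proof
  fix g h k
  let ?G = "R_groupoid D F"
  note simps = R_src R_rng R_inv R_mult F_subset_E1[THEN subsetD] src_in_F rng_in_F E1_src_F E1_rng_F
    mult_in_E1 src_E1_mult rng_E1_mult inv_in_E1 src_E1_inv rng_E1_inv E1_mult_src E1_rng_mult E1_inv_mult E1_mult_inv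
  show "gsrc ?G g \<in> arrows ?G" "grng ?G g \<in> arrows ?G" "gsrc ?G (gsrc ?G g) = gsrc ?G g"
    "grng ?G (gsrc ?G g) = gsrc ?G g" "gsrc ?G (grng ?G g) = grng ?G g" "grng ?G (grng ?G g) = grng ?G g"
    "gmult ?G g (gsrc ?G g) = g" "gmult ?G (grng ?G g) g = g" "ginv ?G g \<in> arrows ?G"
    "gsrc ?G (ginv ?G g) = grng ?G g" "grng ?G (ginv ?G g) = gsrc ?G g"
    "gmult ?G (ginv ?G g) g = gsrc ?G g" "gmult ?G g (ginv ?G g) = grng ?G g"
    if g: "g \<in> arrows ?G"
  proof -
    obtain \<phi> where "\<phi> \<in> E1 D F" "g = modulus \<phi>" using g unfolding arrows_R by blast
    then show "gsrc ?G g \<in> arrows ?G" "grng ?G g \<in> arrows ?G" "gsrc ?G (gsrc ?G g) = gsrc ?G g"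
      "grng ?G (gsrc ?G g) = gsrc ?G g" "gsrc ?G (grng ?G g) = grng ?G g" "grng ?G (grng ?G g) = grng ?G g"
      "gmult ?G g (gsrc ?G g) = g" "gmult ?G (grng ?G g) g = g" "ginv ?G g \<in> arrows ?G"
      "gsrc ?G (ginv ?G g) = grng ?G g" "grng ?G (ginv ?G g) = gsrc ?G g"
      "gmult ?G (ginv ?G g) g = gsrc ?G g" "gmult ?G g (ginv ?G g) = grng ?G g"
      unfolding arrows_R by (simp_all add: simps)
  qed
  show "gmult ?G g h \<in> arrows ?G" "gsrc ?G (gmult ?G g h) = gsrc ?G h" "grng ?G (gmult ?G g h) = grng ?G g"
    if gh: "(g, h) \<in> composable ?G"
  proof -
    obtain \<phi> \<psi> where "\<phi> \<in> E1 D F" "\<psi> \<in> E1 D F" "E1_src D F \<phi> = E1_rng D F \<psi>"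
      "g = modulus \<phi>" "h = modulus \<psi>" using composable_RE[OF gh] .
    then show "gmult ?G g h \<in> arrows ?G" "gsrc ?G (gmult ?G g h) = gsrc ?G h"
      "grng ?G (gmult ?G g h) = grng ?G g"
      unfolding arrows_R by (simp_all add: simps)
  qed
  show "gmult ?G (gmult ?G g h) k = gmult ?G g (gmult ?G h k)"
    if gh: "(g, h) \<in> composable ?G" and hk: "(h, k) \<in> composable ?G"
  proof -
    obtain \<phi> \<psi> where 1: "\<phi> \<in> E1 D F" "\<psi> \<in> E1 D F" "g = modulus \<phi>" "h = modulus \<psi>"
      "E1_src D F \<phi> = E1_rng D F \<psi>"
      using composable_RE[OF gh] by metis
    have "k \<in> arrows ?G" using hk by (simp add: composable_def)
    then obtain \<theta> where 2: "\<theta> \<in> E1 D F" "k = modulus \<theta>" unfolding arrows_R by blast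
    have "E1_src D F \<psi> = E1_rng D F \<theta>" using hk 1 2 composable_R_iff by blast
    with 1 2 show ?thesis by (simp add: simps E1_mult_assoc)
  qed
qed

lemma topological_groupoid_R: "topological_groupoid (R_groupoid D F)"
proof -
  interpret groupoid "R_groupoid D F" by (rule groupoid_R)
  show ?thesis
  proof
    have "continuous_on (modulus ` E1 D F) (\<lambda>\<rho> x. \<rho> (star x))"
      by (intro continuous_on_coordinatewise_then_product continuous_intros)
    then have "continuous_on (modulus ` E1 D F) (ginv (R_groupoid D F))"
      by (rule continuous_on_eq) (auto simp: R_inv modulus_inv)
    then show "continuous_map (gtop (R_groupoid D F)) (gtop (R_groupoid D F)) (ginv (R_groupoid D F))"
      using inv_closed by (auto simp: arrows_R)
  next
    let ?C = "composable (R_groupoid D F)" and ?m = "\<lambda>(g, h). gmult (R_groupoid D F) g h"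
    have "\<exists>U. open U \<and> p \<in> U \<and> continuous_on (?C \<inter> U) ?m" if p: "p \<in> ?C" for p
    proof -
      obtain \<phi> \<psi> where 1: "\<phi> \<in> E1 D F" "\<psi> \<in> E1 D F" "fst p = modulus \<phi>" "snd p = modulus \<psi>"
        using p composable_RE[of "fst p" "snd p"] by (metis prod.collapse)
      obtain v where v: "v \<in> N" "\<psi> v \<noteq> 0" using E1_nonzero[OF 1(2)] .
      let ?U = "(UNIV :: ('a \<Rightarrow> real) set) \<times> {\<sigma>. \<sigma> v \<noteq> (0::real)}"
      \<comment> \<open>This is the absolute value of the product formula, so it involves only the
        two moduli and no lift to functionals.\<close>
      have "continuous_on (?C \<inter> ?U) (\<lambda>p x. fst p (x * star v) / snd p v)"
        by (intro continuous_on_coordinatewise_then_product continuous_intros) auto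
      moreover have "(\<lambda>x. fst q (x * star v) / snd q v) = ?m q" if q: "q \<in> ?C \<inter> ?U" for q
      proof -
        have "(fst q, snd q) \<in> ?C" using q by simp
        then obtain \<phi> \<psi> where 2: "\<phi> \<in> E1 D F" "\<psi> \<in> E1 D F" "E1_src D F \<phi> = E1_rng D F \<psi>"
          "fst q = modulus \<phi>" "snd q = modulus \<psi>" by (rule composable_RE)
        then have "\<psi> v \<noteq> 0" using q by (auto simp: modulus_def)
        then have "(\<lambda>x. fst q (x * star v) / snd q v) = modulus (E1_mult D F \<phi> \<psi>)"
          by (simp add: 2(4,5) modulus_def E1_mult_eq[OF 2(1-3) v(1)] norm_divide)
        also have "\<dots> = ?m q" by (simp add: split_beta 2(4,5) R_mult[OF 2(1-3)])
        finally show ?thesis .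
      qed
      ultimately have "continuous_on (?C \<inter> ?U) ?m" by (rule continuous_on_eq)
      moreover have "open ?U" by (intro open_Times open_UNIV open_eval_neq)
      moreover have "p \<in> ?U" using v 1(4) by (simp add: mem_Times_iff modulus_def)
      ultimately show ?thesis by blast
    qed
    then have "continuous_on ?C ?m" by (rule continuous_on_local)
    moreover have "?m \<in> ?C \<rightarrow> modulus ` E1 D F" using mult_closed by (auto simp: arrows_R)
    moreover have "?C \<subseteq> modulus ` E1 D F \<times> modulus ` E1 D F" by (auto simp: composable_def arrows_R)
    ultimately show "continuous_map (subtopology (prod_topology (gtop (R_groupoid D F)) (gtop (R_groupoid D F))) ?C)
        (gtop (R_groupoid D F)) ?m"
      by (simp add: subtopology_subtopology inf.absorb2)
  qed
qed

lemma lch_groupoid_R: "lch_groupoid (R_groupoid D F)"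
proof -
  interpret topological_groupoid "R_groupoid D F" by (rule topological_groupoid_R)
  show ?thesis
  proof
    show "Hausdorff_space (gtop (R_groupoid D F))"
      by (simp add: Hausdorff_space_fun Hausdorff_space_subtopology)
    let ?T = "top_of_set (modulus ` E1 D F)"
    have "\<exists>U K. openin ?T U \<and> compactin ?T K \<and> \<rho> \<in> U \<and> U \<subseteq> K" if \<rho>: "\<rho> \<in> modulus ` E1 D F" for \<rho>
    proof -
      obtain \<phi> where \<phi>: "\<phi> \<in> E1 D F" "\<rho> = modulus \<phi>" using \<rho> by blast
      obtain v where v: "v \<in> N" "\<phi> v \<noteq> 0" using E1_nonzero[OF \<phi>(1)] .
      define e where "e = cmod (\<phi> v) / 2"
      have e: "0 < e" using v by (simp add: e_def)
      define U where "U = modulus ` E1 D F \<inter> {\<rho>. e < \<rho> v}"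
      define K where "K = modulus ` {\<phi> \<in> E1 D F. e \<le> cmod (\<phi> v)}"
      have "open {\<rho>::'a \<Rightarrow> real. e < \<rho> v}" by (intro open_Collect_less continuous_intros)
      then have "openin ?T U" unfolding U_def by blast
      moreover have "compact K"
        unfolding K_def by (intro compact_continuous_image continuous_on_modulus compact_E1_level v e)
      then have "compactin ?T K" by (auto simp: K_def compactin_subtopology)
      moreover have "\<rho> \<in> U" using \<phi> e by (auto simp: U_def e_def modulus_def)
      moreover have "U \<subseteq> K" by (force simp: U_def K_def modulus_def)
      ultimately show ?thesis by blast
    qed
    then show "locally_compact_space (gtop (R_groupoid D F))"
      by (simp add: locally_compact_space_def)
  qed
qed

section \<open>Units of the absolute values and the etale property\<close>

lemma unit_space_R: "unit_space (R_groupoid D F) = modulus ` F"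
proof -
  have "unit_space (R_groupoid D F) = modulus ` (E1_src D F ` E1 D F)"
    unfolding unit_space_def arrows_R image_image by (intro image_cong) (simp_all add: R_src)
  also have "E1_src D F ` E1 D F = F"
    using unit_space_E1 by (simp add: unit_space_def arrows_E1)
  finally show ?thesis .
qed

lemma unit_topology_R:
  "subtopology (gtop (R_groupoid D F)) (unit_space (R_groupoid D F)) = top_of_set (modulus ` F)"
  using image_mono[OF F_subset_E1, of modulus]
  by (simp add: unit_space_R subtopology_subtopology inf.absorb2)

lemma homeomorphic_map_modulus: "homeomorphic_map (top_of_set F) (top_of_set (modulus ` F)) modulus"
proof (rule homeomorphic_map_top_of_setI)
  show "continuous_on F modulus" by (rule continuous_on_modulus)
  show "continuous_on (modulus ` F) unmodulus"
    by (rule continuous_on_unmodulus[OF continuous_on_evals(1)])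
qed (auto simp: unmodulus_modulus F_state)

lemma modulus_weight: "modulus f (star v * v) = weight f v" if f: "f \<in> F"
proof -
  have "cmod (f (star v * v)) = cmod (complex_of_real (weight f v))"
    by (rule arg_cong[OF F_weight[OF f]])
  then show ?thesis using F_weight_nonneg[OF f, of v] by (simp add: modulus_def)
qed

text \<open>The absolute value of \<open>[v, f]\<close> depends on \<open>f\<close> only through
  \<open>modulus f\<close>; hence the inverse of the source can be written on absolute
  values.\<close>

lemma modulus_bracket:
  assumes f: "f \<in> F"
  shows "modulus (bracket v f) = (\<lambda>x. modulus f (star v * x) / sqrt (modulus f (star v * v)))"
  unfolding modulus_weight[OF f] using F_weight_nonneg[OF f, of v]
  by (simp add: modulus_def bracket_eq[OF f] norm_divide)

lemma modulus_eq_bracket: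
  "\<lbrakk>\<phi> \<in> E1 D F; v \<in> N; \<phi> v \<noteq> 0\<rbrakk> \<Longrightarrow> modulus \<phi> = modulus (bracket v (E1_src D F \<phi>))"
proof
  fix x assume a: "\<phi> \<in> E1 D F" "v \<in> N" "\<phi> v \<noteq> 0"
  have "cmod (\<phi> x) = cmod (sgn (\<phi> v) * bracket v (E1_src D F \<phi>) x)"
    by (rule arg_cong[OF E1_eq_bracket[OF a]])
  then show "modulus \<phi> x = modulus (bracket v (E1_src D F \<phi>)) x"
    using a(3) by (simp add: modulus_def norm_mult norm_sgn)
qed

lemma local_homeomorphism_src:
  "local_homeomorphism_map (gtop (R_groupoid D F)) (top_of_set (modulus ` F)) (gsrc (R_groupoid D F))"
  unfolding local_homeomorphism_map_def
proof
  let ?s = "gsrc (R_groupoid D F)"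
  fix \<rho> assume "\<rho> \<in> topspace (gtop (R_groupoid D F))"
  then obtain \<phi> where \<phi>: "\<phi> \<in> E1 D F" "\<rho> = modulus \<phi>" by auto
  obtain v where v: "v \<in> N" "\<phi> v \<noteq> 0" using E1_nonzero[OF \<phi>(1)] .
  define U where "U = modulus ` E1 D F \<inter> {\<rho>. \<rho> v \<noteq> 0}"
  define V where "V = modulus ` F \<inter> {\<tau>. \<tau> (star v * v) \<noteq> 0}"
  \<comment> \<open>This sends the absolute value of \<open>f\<close> to that of
    \<open>[v, f]\<close> and is the local inverse of the source.\<close>
  define \<kappa> where "\<kappa> = (\<lambda>\<tau>::'a \<Rightarrow> real. \<lambda>x. \<tau> (star v * x) / sqrt (\<tau> (star v * v)))"
  \<comment> \<open>The last conjunct replaces the description behind the source by an explicit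
    quotient, from which continuity on \<open>U\<close> follows.\<close>
  have U: "?s \<rho> \<in> V \<and> \<kappa> (?s \<rho>) = \<rho> \<and> ?s \<rho> = (\<lambda>x. \<rho> (v * x) / \<rho> v)" if \<rho>: "\<rho> \<in> U" for \<rho>
  proof -
    obtain \<phi> where \<phi>: "\<phi> \<in> E1 D F" "\<rho> = modulus \<phi>" "\<phi> v \<noteq> 0"
      using \<rho> by (auto simp: U_def modulus_def)
    have s: "?s \<rho> = modulus (E1_src D F \<phi>)" using \<phi> by (simp add: R_src)
    have w: "modulus (E1_src D F \<phi>) (star v * v) \<noteq> 0"
      using src_weight_nonzero[OF \<phi>(1) v(1) \<phi>(3)] by (simp add: modulus_weight[OF src_in_F[OF \<phi>(1)]])
    have "\<kappa> (?s \<rho>) = modulus (bracket v (E1_src D F \<phi>))"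
      unfolding s \<kappa>_def modulus_bracket[OF src_in_F[OF \<phi>(1)]] ..
    also have "\<dots> = \<rho>" unfolding \<phi>(2) by (rule modulus_eq_bracket[OF \<phi>(1) v(1) \<phi>(3), symmetric])
    finally have "\<kappa> (?s \<rho>) = \<rho>" .
    moreover have "?s \<rho> \<in> V" unfolding s V_def using w src_in_F[OF \<phi>(1)] by blast
    moreover have "?s \<rho> = (\<lambda>x. \<rho> (v * x) / \<rho> v)"
      unfolding s unfolding \<phi>(2) by (rule modulus_src[OF \<phi>(1) v(1) \<phi>(3)])
    ultimately show ?thesis by blast
  qed
  have V: "\<kappa> \<tau> \<in> U \<and> ?s (\<kappa> \<tau>) = \<tau>" if \<tau>: "\<tau> \<in> V" for \<tau>
  proof -
    obtain f where f: "f \<in> F" "\<tau> = modulus f" "weight f v \<noteq> 0"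
      using \<tau> modulus_weight by (fastforce simp: V_def)
    have b: "bracket v f \<in> E1 D F" using f v by (simp add: bracket_in_E1)
    have k: "\<kappa> \<tau> = modulus (bracket v f)"
      unfolding f(2) \<kappa>_def modulus_bracket[OF f(1)] ..
    have "?s (\<kappa> \<tau>) = \<tau>" unfolding k R_src[OF b] using f v by (simp add: E1_src_bracket)
    moreover have "\<kappa> \<tau> \<in> U" unfolding k U_def using f b by (simp add: modulus_def bracket_self)
    ultimately show ?thesis by blast
  qed
  have sU: "?s ` U = V"
  proof
    show "?s ` U \<subseteq> V" using U by blast
    show "V \<subseteq> ?s ` U"
    proof
      fix \<tau> assume "\<tau> \<in> V"
      from V[OF this] show "\<tau> \<in> ?s ` U" by (metis imageI)
    qed
  qed
  have "openin (top_of_set (modulus ` E1 D F)) U" "openin (top_of_set (modulus ` F)) V"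
    unfolding U_def V_def by (rule openin_open_Int, rule open_eval_neq)+
  moreover have "\<rho> \<in> U" using \<phi> v by (simp add: U_def modulus_def)
  moreover have "homeomorphic_map (top_of_set U) (top_of_set V) ?s"
  proof (rule homeomorphic_map_top_of_setI)
    have "continuous_on U (\<lambda>\<rho> x. \<rho> (v * x) / \<rho> v)"
      by (intro continuous_on_coordinatewise_then_product continuous_intros) (auto simp: U_def)
    then show "continuous_on U ?s" by (rule continuous_on_eq) (simp only: U)
    show "continuous_on V \<kappa>" unfolding \<kappa>_def
      by (intro continuous_on_coordinatewise_then_product continuous_intros) (auto simp: V_def)
    show "?s \<rho> \<in> V \<and> \<kappa> (?s \<rho>) = \<rho>" if "\<rho> \<in> U" for \<rho> using U[OF that] by blast
    show "\<kappa> \<tau> \<in> U \<and> ?s (\<kappa> \<tau>) = \<tau>" if "\<tau> \<in> V" for \<tau> using V[OF that] by blast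
  qed
  moreover have "modulus ` E1 D F \<inter> U = U" "modulus ` F \<inter> V = V" by (auto simp: U_def V_def)
  ultimately show "\<exists>U. openin (gtop (R_groupoid D F)) U \<and> \<rho> \<in> U \<and> openin (top_of_set (modulus ` F)) (?s ` U) \<and>
      homeomorphic_map (subtopology (gtop (R_groupoid D F)) U) (subtopology (top_of_set (modulus ` F)) (?s ` U)) ?s"
    by (intro exI[of _ U]) (simp add: sU subtopology_subtopology)
qed

lemma etale_groupoid_R: "etale_groupoid (R_groupoid D F)"
proof -
  interpret topological_groupoid "R_groupoid D F" by (rule topological_groupoid_R)
  let ?G = "R_groupoid D F"
  have ii: "ginv ?G (ginv ?G \<rho>) = \<rho>" if "\<rho> \<in> arrows ?G" for \<rho>
    using that by (auto simp: arrows_R R_inv inv_in_E1 E1_inv_inv)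
  have "homeomorphic_map (gtop ?G) (gtop ?G) (ginv ?G)"
    unfolding homeomorphic_map_maps homeomorphic_maps_def
    using continuous_inv ii by (intro exI[of _ "ginv ?G"]) (auto simp: arrows_def)
  then have "local_homeomorphism_map (gtop ?G) (top_of_set (modulus ` F)) (grng ?G)"
    by (rule local_homeomorphism_map_compose[OF local_homeomorphism_src])
      (auto simp: R_src R_rng R_inv inv_in_E1 src_E1_inv)
  with local_homeomorphism_src show ?thesis
    by unfold_locales (simp_all only: unit_topology_R)
qed

section \<open>The twist\<close>

lemma homeomorphic_map_act:
  assumes z: "z \<in> circle"
  shows "homeomorphic_map (top_of_set (E1 D F)) (top_of_set (E1 D F)) (E1_act z)"
proof (rule homeomorphic_map_top_of_setI)
  have cont: "continuous_on (E1 D F) (E1_act w)" for w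
    unfolding E1_act_def by (intro continuous_on_coordinatewise_then_product continuous_intros)
  show "continuous_on (E1 D F) (E1_act z)" "continuous_on (E1 D F) (E1_act (cnj z))"
    by (rule cont)+
  have z': "cnj z \<in> circle" using z by simp
  have inv: "cnj z * (z * x) = x" "z * (cnj z * x) = x" for x
  proof -
    have "z * cnj z = 1" using z by (simp flip: complex_norm_square)
    then show "cnj z * (z * x) = x" "z * (cnj z * x) = x" by (simp_all flip: mult.assoc add: mult.commute[of "cnj z"])
  qed
  show "E1_act z \<phi> \<in> E1 D F \<and> E1_act (cnj z) (E1_act z \<phi>) = \<phi>" if "\<phi> \<in> E1 D F" for \<phi>
    using E1_act_in_E1[OF that z] by (simp add: E1_act_eq that inv)
  show "E1_act (cnj z) \<phi> \<in> E1 D F \<and> E1_act z (E1_act (cnj z) \<phi>) = \<phi>" if "\<phi> \<in> E1 D F" for \<phi>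
    using E1_act_in_E1[OF that z'] by (simp add: E1_act_eq that inv)
qed

lemma modulus_fibre:
  assumes \<phi>: "\<phi> \<in> E1 D F"
  shows "{\<psi> \<in> E1 D F. modulus \<psi> = modulus \<phi>} = (\<lambda>z. E1_act z \<phi>) ` circle"
proof
  show "{\<psi> \<in> E1 D F. modulus \<psi> = modulus \<phi>} \<subseteq> (\<lambda>z. E1_act z \<phi>) ` circle"
  proof
    fix \<psi> assume "\<psi> \<in> {\<psi> \<in> E1 D F. modulus \<psi> = modulus \<phi>}"
    then have "\<psi> \<in> E1 D F" "modulus \<psi> = modulus \<phi>" by auto
    then obtain z where "z \<in> circle" "\<psi> = E1_act z \<phi>" using modulus_eqE \<phi> by metis
    then show "\<psi> \<in> (\<lambda>z. E1_act z \<phi>) ` circle" by (rule rev_image_eqI)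
  qed
  show "(\<lambda>z. E1_act z \<phi>) ` circle \<subseteq> {\<psi> \<in> E1 D F. modulus \<psi> = modulus \<phi>}"
    using E1_act_in_E1[OF \<phi>] modulus_act[OF \<phi>] by blast
qed

text \<open>Over the open set where \<open>\<rho> v \<noteq> 0\<close> the section is \<open>\<rho> \<mapsto> [v, \<s>(\<rho>)]\<close>, with the state
  \<open>\<s>(\<rho>)\<close> recovered from its absolute value \<open>x \<mapsto> \<rho> (v * x) / \<rho> v\<close>.\<close>

lemma local_trivialization:
  assumes v: "v \<in> N"
  defines "U \<equiv> modulus ` E1 D F \<inter> {\<rho>. \<rho> v \<noteq> 0}"
  defines "h \<equiv> \<lambda>(\<rho>, z). \<lambda>x. z * (unmodulus (\<lambda>y. \<rho> (v * y) / \<rho> v) (star v * x) / complex_of_real (\<rho> v))"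
  shows "homeomorphic_map (prod_topology (top_of_set U) (top_of_set circle))
      (top_of_set {\<phi> \<in> E1 D F. modulus \<phi> \<in> U}) h"
    and "\<lbrakk>\<rho> \<in> U; z \<in> circle\<rbrakk> \<Longrightarrow> modulus (h (\<rho>, z)) = \<rho>"
    and "\<lbrakk>\<rho> \<in> U; z \<in> circle; w \<in> circle\<rbrakk> \<Longrightarrow> h (\<rho>, w * z) = E1_act w (h (\<rho>, z))"
proof -
  \<comment> \<open>The inverse chart: base point and phase at \<open>v\<close>.\<close>
  define g where "g = (\<lambda>\<phi>::'a \<Rightarrow> complex. (modulus \<phi>, sgn (\<phi> v)))"
  have h_modulus: "h (modulus \<phi>, z) = (\<lambda>x. z * bracket v (E1_src D F \<phi>) x)"
    if \<phi>: "\<phi> \<in> E1 D F" "\<phi> v \<noteq> 0" for \<phi> z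
  proof -
    have f: "E1_src D F \<phi> \<in> F" using \<phi>(1) by (rule src_in_F)
    have "unmodulus (\<lambda>y. modulus \<phi> (v * y) / modulus \<phi> v) = E1_src D F \<phi>"
      unfolding modulus_src[OF \<phi>(1) v \<phi>(2), symmetric] by (rule unmodulus_modulus[OF F_state[OF f]])
    moreover have "modulus \<phi> v = sqrt (weight (E1_src D F \<phi>) v)"
      by (simp add: src_weight[OF \<phi>(1) v \<phi>(2)] modulus_def)
    ultimately show ?thesis unfolding h_def prod.case bracket_eq[OF f] by metis
  qed
  \<comment> \<open>The witness is the functional over \<open>\<rho>\<close> that is positive at
    \<open>v\<close>; the fibre coordinate \<open>z\<close> then acts on it, and its phase at
    \<open>v\<close> reads \<open>z\<close> back.\<close>
  have U: "\<exists>\<phi>\<in>E1 D F. \<rho> = modulus \<phi> \<and> \<phi> v = of_real (\<rho> v) \<and> 0 < \<rho> v \<and>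
      (\<forall>z. h (\<rho>, z) = E1_act z \<phi>)" if \<rho>: "\<rho> \<in> U" for \<rho>
  proof -
    obtain \<phi> where \<phi>: "\<phi> \<in> E1 D F" "\<rho> = modulus \<phi>" "\<phi> v \<noteq> 0"
      using \<rho> by (auto simp: U_def modulus_def)
    let ?f = "E1_src D F \<phi>" let ?\<psi> = "bracket v (E1_src D F \<phi>)"
    have f: "?f \<in> F" using \<phi>(1) by (rule src_in_F)
    have w: "weight ?f v = (cmod (\<phi> v))\<^sup>2" by (rule src_weight[OF \<phi>(1) v \<phi>(3)])
    have \<psi>: "?\<psi> \<in> E1 D F" using f v \<phi>(3) w by (simp add: bracket_in_E1)
    moreover have "\<rho> = modulus ?\<psi>" unfolding \<phi>(2) by (rule modulus_eq_bracket[OF \<phi>(1) v \<phi>(3)])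
    moreover have "?\<psi> v = of_real (\<rho> v)" unfolding bracket_self[OF f] w \<phi>(2) by (simp add: modulus_def)
    moreover have "0 < \<rho> v" using \<phi> by (simp add: modulus_def)
    moreover have "h (\<rho>, z) = E1_act z ?\<psi>" for z
      unfolding \<phi>(2) h_modulus[OF \<phi>(1,3)] E1_act_eq[OF \<psi>] ..
    ultimately show ?thesis by blast
  qed
  show m: "modulus (h (\<rho>, z)) = \<rho>" if "\<rho> \<in> U" "z \<in> circle" for \<rho> z
    using U[OF that(1)] modulus_act[OF _ that(2)] by auto
  show "h (\<rho>, w * z) = E1_act w (h (\<rho>, z))" if h': "\<rho> \<in> U" "z \<in> circle" "w \<in> circle" for \<rho> w z
  proof -
    obtain \<phi> where \<phi>: "\<phi> \<in> E1 D F" "\<forall>z. h (\<rho>, z) = E1_act z \<phi>" using U[OF h'(1)] by blast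
    have "E1_act z \<phi> \<in> E1 D F" using \<phi>(1) h'(2) by (rule E1_act_in_E1)
    then have "E1_act w (E1_act z \<phi>) = E1_act (w * z) \<phi>" using \<phi>(1)
      unfolding E1_act_eq[OF \<open>E1_act z \<phi> \<in> E1 D F\<close>] by (simp add: E1_act_eq mult.assoc)
    then show ?thesis using \<phi>(2) by simp
  qed
  have prod: "prod_topology (top_of_set U) (top_of_set circle) = top_of_set (U \<times> circle)"
    by (simp flip: subtopology_Times)
  show "homeomorphic_map (prod_topology (top_of_set U) (top_of_set circle))
      (top_of_set {\<phi> \<in> E1 D F. modulus \<phi> \<in> U}) h"
    unfolding prod
  proof (rule homeomorphic_map_top_of_setI)
    have un: "continuous_on (U \<times> circle) (\<lambda>p. unmodulus (\<lambda>y. fst p (v * y) / fst p v))"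
      by (rule continuous_on_unmodulus) (auto intro!: continuous_intros simp: U_def)
    have "continuous_on (U \<times> circle) (\<lambda>p x. snd p * (unmodulus (\<lambda>y. fst p (v * y) / fst p v) (star v * x) / complex_of_real (fst p v)))"
    proof (rule continuous_on_coordinatewise_then_product)
      show "continuous_on (U \<times> circle) (\<lambda>p. snd p * (unmodulus (\<lambda>y. fst p (v * y) / fst p v) (star v * x) / complex_of_real (fst p v)))" for x
        by (intro continuous_on_mult continuous_on_divide continuous_on_eval[OF un] continuous_intros)
          (auto simp: U_def)
    qed
    then show "continuous_on (U \<times> circle) h" by (simp add: h_def split_beta')
    have "continuous_on {\<phi> \<in> E1 D F. modulus \<phi> \<in> U} (\<lambda>\<phi>. sgn (\<phi> v))"
      unfolding sgn_div_norm by (intro continuous_intros) (auto simp: U_def modulus_def)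
    then show "continuous_on {\<phi> \<in> E1 D F. modulus \<phi> \<in> U} g"
      unfolding g_def by (intro continuous_on_Pair continuous_on_modulus)
  next
    fix p assume p: "p \<in> U \<times> circle"
    obtain \<rho> z where \<rho>: "p = (\<rho>, z)" "\<rho> \<in> U" "z \<in> circle" using p by auto
    obtain \<phi> where \<phi>: "\<phi> \<in> E1 D F" "\<phi> v = of_real (\<rho> v)" "0 < \<rho> v" and hz: "h (\<rho>, z) = E1_act z \<phi>"
      using U[OF \<rho>(2)] by blast
    have "h p \<in> E1 D F" unfolding \<rho>(1) hz using \<phi>(1) \<rho>(3) by (rule E1_act_in_E1)
    moreover have "modulus (h p) = \<rho>" unfolding \<rho>(1) by (rule m[OF \<rho>(2,3)])
    moreover have "sgn (h p v) = z"
      unfolding \<rho>(1) hz E1_act_eq[OF \<phi>(1)] \<phi>(2) using \<phi>(3) \<rho>(3) by (simp add: sgn_eq norm_mult)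
    ultimately show "h p \<in> {\<phi> \<in> E1 D F. modulus \<phi> \<in> U} \<and> g (h p) = p"
      using \<rho> by (simp add: g_def)
  next
    fix \<phi> assume "\<phi> \<in> {\<phi> \<in> E1 D F. modulus \<phi> \<in> U}"
    then have \<phi>: "\<phi> \<in> E1 D F" "\<phi> v \<noteq> 0" "modulus \<phi> \<in> U" by (auto simp: U_def modulus_def)
    have "h (g \<phi>) = \<phi>"
      unfolding g_def h_modulus[OF \<phi>(1,2)] by (rule ext) (rule E1_eq_bracket[OF \<phi>(1) v \<phi>(2), symmetric])
    then show "g \<phi> \<in> U \<times> circle \<and> h (g \<phi>) = \<phi>"
      using \<phi> by (simp add: g_def norm_sgn)
  qed
qed

lemma twist_E1: "twist (E1_groupoid D F) (R_groupoid D F) E1_act modulus"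
proof -
  interpret S: lch_groupoid "E1_groupoid D F" by (rule lch_groupoid_E1)
  interpret G: lch_groupoid "R_groupoid D F" by (rule lch_groupoid_R)
  interpret G: etale_groupoid "R_groupoid D F" by (rule etale_groupoid_R)
  show ?thesis
  proof (unfold_locales, goal_cases)
    case (1 \<phi>)
    then show ?case by (simp add: E1_act_def)
  next
    case (2 z w \<phi>)
    then show ?case by (simp add: E1_act_def scaleC_scaleC mult.commute)
  next
    case (3 z)
    then show ?case using homeomorphic_map_act by simp
  next
    case (4 z \<phi>)
    then have \<phi>: "\<phi> \<in> E1 D F" by (simp add: arrows_E1)
    obtain v where "\<phi> v \<noteq> 0" using E1_nonzero[OF \<phi>] .
    moreover have "z * \<phi> v = \<phi> v" using 4(3) unfolding E1_act_eq[OF \<phi>] by metis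
    ultimately show ?case by simp
  next
    case (5 z w \<phi> \<psi>)
    then show ?case by (simp add: composable_E1 E1_act_in_E1 src_act rng_act)
  next
    case (6 z w \<phi> \<psi>)
    then show ?case by (simp add: composable_E1 E1_mult_act)
  next
    case 7
    show ?case by (simp add: continuous_on_modulus)
  next
    case 8
    show ?case by (simp add: arrows_E1 arrows_R)
  next
    case (9 \<phi> \<psi>)
    then show ?case by (simp add: composable_E1 composable_R_iff)
  next
    case (10 \<phi> \<psi>)
    then show ?case by (simp add: composable_E1 R_mult)
  next
    case (11 \<phi>)
    then show ?case unfolding arrows_E1 by (rule modulus_fibre)
  next
    case (12 g)
    then obtain \<phi> where \<phi>: "\<phi> \<in> E1 D F" "g = modulus \<phi>" unfolding arrows_R by blast
    obtain v where v: "v \<in> N" "\<phi> v \<noteq> 0" using E1_nonzero[OF \<phi>(1)] .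
    define U where "U = modulus ` E1 D F \<inter> {\<rho>. \<rho> v \<noteq> 0}"
    have "openin (gtop (R_groupoid D F)) U"
      unfolding R_gtop
      U_def by (rule openin_open_Int, rule open_eval_neq)
    moreover have "g \<in> U" using \<phi> v by (simp add: U_def modulus_def)
    moreover have "subtopology (gtop (R_groupoid D F)) U = top_of_set U"
      by (simp add: U_def subtopology_subtopology inf.absorb2)
    moreover have "subtopology (gtop (E1_groupoid D F)) {\<psi> \<in> arrows (E1_groupoid D F). modulus \<psi> \<in> U}
        = top_of_set {\<psi> \<in> E1 D F. modulus \<psi> \<in> U}"
      by (simp add: arrows_E1 subtopology_subtopology inf.absorb2)
    ultimately show ?case
      using local_trivialization[OF v(1), folded U_def]
      by (intro exI[of _ U] exI conjI ballI) (simp_all only:)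
  qed
qed

end

theorem theorem8p12:
  fixes D :: "'a::unital_cstar_algebra set" and F :: "('a \<Rightarrow> complex) set"
  assumes "regular_inclusion D"
    and "F \<subseteq> compatible_states D"
    and "closedin (top_of_set (compatible_states D)) F"
    and "normalizer_invariant D F"
    and "(\<lambda>f. restrict f D) ` F = characters D"
  shows "lch_groupoid (E1_groupoid D F) \<and>
     lch_groupoid (R_groupoid D F) \<and>
     etale_groupoid (R_groupoid D F) \<and>
     unit_space (E1_groupoid D F) = F \<and>
     unit_space (R_groupoid D F) = modulus ` F \<and>
     homeomorphic_map (top_of_set F)
           (subtopology (gtop (R_groupoid D F)) (unit_space (R_groupoid D F))) modulus \<and>
     twist (E1_groupoid D F) (R_groupoid D F) E1_act modulus"
proof -
  interpret invariant_state_set D F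
    using assms by unfold_locales (simp_all add: regular_inclusion_def)
  show ?thesis
    unfolding unit_topology_R
    by (intro conjI lch_groupoid_E1 lch_groupoid_R etale_groupoid_R unit_space_E1 unit_space_R
        homeomorphic_map_modulus twist_E1)
qed

end
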